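(* Let $\mathbb{F}$ be an algebraically closed field with $\mathrm{Char}(\mathbb{F})\neq 2$, let $L=\mathfrak{sl}_2(\mathbb{F})$, and let $N$ be a feasible integer. Let $V$ be a vector space over $\mathbb{F}$ of dimension $N+1$ and let $A,A^*$ be a Leonard pair on $V$ that has Krawtchouk type. Then there exist an $L$-module structure on $V$ and a pair of normalized semisimple elements of $L$ that generate $L$ as a Lie algebra and act on $V$ as $A$ and $A^*$ respectively. This $L$-module $V$ is isomorphic to the $L$-module $\mathrm{Hom}_N(\mathbb{F}[y,z])$.
   Context: $L=\mathfrak{sl}_2(\mathbb{F})$ is the Lie algebra of trace-zero $2\times 2$ matrices over $\mathbb{F}$ with bracket $[u,v]=uv-vu$, and basis $e=\begin{pmatrix}0&1\\0&0\end{pmatrix}$, $h=\begin{pmatrix}1&0\\0&-1\end{pmatrix}$, $f=\begin{pmatrix}0&0\\1&0\end{pmatrix}$. The bilinear form $\langle u,v\rangle$ on $L$ is $\frac18$ times the Killing form; equivalently $\langle u,v\rangle=\mathrm{tr}(uv)/2$. Write $\|u\|^2=\langle u,u\rangle$. An element $u\in L$ is semisimple if $\mathrm{ad}\,u:L\to L$ is diagonalizable; a semisimple $u$ is normalized if $\|u\|^2=1$. An integer $N$ is feasible if $N\ge 0$ when $\mathrm{Char}(\mathbb{F})=0$, and $0\le N<\mathrm{Char}(\mathbb{F})$ when $\mathrm{Char}(\mathbb{F})>0$. $L$ acts on $\mathbb{F}[y,z]$ ($y,z$ commuting indeterminates) by derivations, determined by $e.y=0$, $h.y=y$, $f.y=z$,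 $e.z=y$, $h.z=-z$, $f.z=0$. The subspace $\mathrm{Hom}_N(\mathbb{F}[y,z])=\mathrm{Span}\{y^{N-i}z^i\}_{i=0}^N$ is an $L$-submodule. A tridiagonal matrix is irreducible if each subdiagonal entry and each superdiagonal entry is nonzero. A Leonard pair on a vector space $V$ of finite positive dimension is an ordered pair of linear maps $A,A^*:V\to V$ such that (i) there is a basis of $V$ with respect to which the matrix representing $A$ is irreducible tridiagonal and the matrix representing $A^*$ is diagonal; (ii) there is a basis of $V$ with respect to which the matrix representing $A$ is diagonal and the matrix representing $A^*$ is irreducible tridiagonal. Its diameter is $\dim V-1$. For a Leonard pair, an eigenvalue sequence is the sequence of diagonal entries, in order, of the matrix representing $A$ with respect to some basis as in (ii); a dual eigenvalue sequence is the sequence of diagonal entries, in order, of the matrix representing $A^*$ with respect to some basis as in (i). A Leonard pair of diameter $N$ ($N$ feasible) has Krawtchouk type if $\{N-2i\}_{i=0}^N$ is both an eigenvalue sequence and a dual eigenvalue sequence of it. *)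

theory Defs
  imports "HOL-Analysis.Analysis" "HOL-Computational_Algebra.Computational_Algebra"
begin

section \<open>The Lie algebra \<open>sl\<^sub>2\<close>\<close>

definition mat_scale :: "'a::field \<Rightarrow> 'a^2^2 \<Rightarrow> 'a^2^2" where
  "mat_scale c u = (\<chi> i j. c * u $ i $ j)"

interpretation mat2: vector_space "mat_scale :: 'a::field \<Rightarrow> _"
  by unfold_locales (simp_all add: mat_scale_def vec_eq_iff algebra_simps)

definition sl2 :: "('a::field^2^2) set" where
  "sl2 = {u. trace u = 0}"

definition lie_bracket :: "'a::field^2^2 \<Rightarrow> 'a^2^2 \<Rightarrow> 'a^2^2" where
  "lie_bracket u v = u ** v - v ** u"

definition sl2_e :: "'a::field^2^2" where
  "sl2_e = vector [vector [0, 1], vector [0, 0]]"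

definition sl2_h :: "'a::field^2^2" where
  "sl2_h = vector [vector [1, 0], vector [0, -1]]"

definition sl2_f :: "'a::field^2^2" where
  "sl2_f = vector [vector [0, 0], vector [1, 0]]"

text \<open>The trace of \<open>ad u \<circ> ad v\<close> on \<open>sl\<^sub>2\<close>, computed in the basis \<open>e, h, f\<close>.\<close>

definition killing_form :: "'a::field^2^2 \<Rightarrow> 'a^2^2 \<Rightarrow> 'a" where
  "killing_form u v =
     (\<Sum>b\<in>{sl2_e, sl2_h, sl2_f}.
        mat2.representation {sl2_e, sl2_h, sl2_f} (lie_bracket u (lie_bracket v b)) b)"

text \<open>Meaningful only when the characteristic is not 2.\<close>

definition sl2_form :: "'a::field^2^2 \<Rightarrow> 'a^2^2 \<Rightarrow> 'a" where
  "sl2_form u v = killing_form u v / 8"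

definition semisimple :: "'a::field^2^2 \<Rightarrow> bool" where
  "semisimple u \<longleftrightarrow> u \<in> sl2 \<and>
     (\<exists>B. mat2.independent B \<and> mat2.span B = sl2 \<and>
          (\<forall>b\<in>B. \<exists>c. lie_bracket u b = mat_scale c b))"

definition normalized_semisimple :: "'a::field^2^2 \<Rightarrow> bool" where
  "normalized_semisimple u \<longleftrightarrow> semisimple u \<and> sl2_form u u = 1"

definition lie_subalgebra :: "('a::field^2^2) set \<Rightarrow> bool" where
  "lie_subalgebra S \<longleftrightarrow>
     mat2.subspace S \<and> S \<subseteq> sl2 \<and> (\<forall>u\<in>S. \<forall>v\<in>S. lie_bracket u v \<in> S)"

definition generates_sl2 :: "('a::field^2^2) set \<Rightarrow> bool" where
  "generates_sl2 X \<longleftrightarrow> X \<subseteq> sl2 \<and> lie_subalgebra hull X = sl2"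

section \<open>\<open>sl\<^sub>2\<close>-modules\<close>

text \<open>The carrier \<open>W\<close> is a subspace of the ambient vector space; values of \<open>act u w\<close> with
  \<open>u\<close> outside \<open>sl2\<close> or \<open>w\<close> outside \<open>W\<close> are irrelevant.\<close>

definition sl2_module ::
  "('a::field \<Rightarrow> 'v::ab_group_add \<Rightarrow> 'v) \<Rightarrow> 'v set \<Rightarrow> ('a^2^2 \<Rightarrow> 'v \<Rightarrow> 'v) \<Rightarrow> bool" where
  "sl2_module scl W act \<longleftrightarrow>
     vector_space scl \<and> module.subspace scl W \<and>
     (\<forall>u\<in>sl2. \<forall>w\<in>W. act u w \<in> W) \<and>
     (\<forall>u\<in>sl2. \<forall>w\<in>W. \<forall>w'\<in>W. act u (w + w') = act u w + act u w') \<and>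
     (\<forall>u\<in>sl2. \<forall>w\<in>W. \<forall>c. act u (scl c w) = scl c (act u w)) \<and>
     (\<forall>u\<in>sl2. \<forall>v\<in>sl2. \<forall>w\<in>W. act (u + v) w = act u w + act v w) \<and>
     (\<forall>u\<in>sl2. \<forall>w\<in>W. \<forall>c. act (mat_scale c u) w = scl c (act u w)) \<and>
     (\<forall>u\<in>sl2. \<forall>v\<in>sl2. \<forall>w\<in>W. act (lie_bracket u v) w = act u (act v w) - act v (act u w))"

definition sl2_module_isomorphic ::
  "('a::field \<Rightarrow> 'v::ab_group_add \<Rightarrow> 'v) \<Rightarrow> 'v set \<Rightarrow> ('a^2^2 \<Rightarrow> 'v \<Rightarrow> 'v) \<Rightarrow>
   ('a \<Rightarrow> 'w::ab_group_add \<Rightarrow> 'w) \<Rightarrow> 'w set \<Rightarrow> ('a^2^2 \<Rightarrow> 'w \<Rightarrow> 'w) \<Rightarrow> bool" where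
  "sl2_module_isomorphic scl W act scl' W' act' \<longleftrightarrow>
     (\<exists>\<phi>. bij_betw \<phi> W W' \<and>
          (\<forall>x\<in>W. \<forall>y\<in>W. \<phi> (x + y) = \<phi> x + \<phi> y) \<and>
          (\<forall>c. \<forall>x\<in>W. \<phi> (scl c x) = scl' c (\<phi> x)) \<and>
          (\<forall>u\<in>sl2. \<forall>x\<in>W. \<phi> (act u x) = act' u (\<phi> x)))"

section \<open>The action on polynomials in two variables\<close>

text \<open>\<open>'a poly poly\<close> is read as \<open>F[y][z]\<close>: the inner variable is \<open>y\<close>, the outer one is \<open>z\<close>.\<close>

definition var_y :: "'a::field poly poly" where
  "var_y = [:[:0, 1:]:]"

definition var_z :: "'a::field poly poly" where
  "var_z = [:0, 1:]"

definition bipoly_scale :: "'a::field \<Rightarrow> 'a poly poly \<Rightarrow> 'a poly poly" where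
  "bipoly_scale c p = smult [:c:] p"

interpretation bipoly: vector_space "bipoly_scale :: 'a::field \<Rightarrow> _"
  by unfold_locales
    (simp_all add: bipoly_scale_def poly_eq_iff ring_distribs mult.assoc)

definition partial_y :: "'a::field poly poly \<Rightarrow> 'a poly poly" where
  "partial_y = map_poly pderiv"

definition partial_z :: "'a::field poly poly \<Rightarrow> 'a poly poly" where
  "partial_z = pderiv"

text \<open>For \<open>u = u\<^sub>1\<^sub>2 e + u\<^sub>1\<^sub>1 h + u\<^sub>2\<^sub>1 f\<close> in \<open>sl\<^sub>2\<close> this is the derivation with
  \<open>y \<mapsto> u\<^sub>1\<^sub>1 y + u\<^sub>2\<^sub>1 z\<close> and \<open>z \<mapsto> u\<^sub>1\<^sub>2 y - u\<^sub>1\<^sub>1 z\<close>; see the lemmas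
  \<open>bipoly_act_derivation\<close>, \<open>bipoly_act_generators\<close> and \<open>bipoly_act_unique\<close> below.\<close>

definition bipoly_act :: "'a::field^2^2 \<Rightarrow> 'a poly poly \<Rightarrow> 'a poly poly" where
  "bipoly_act u p =
     (bipoly_scale (u $ 1 $ 1) var_y + bipoly_scale (u $ 2 $ 1) var_z) * partial_y p +
     (bipoly_scale (u $ 1 $ 2) var_y + bipoly_scale (u $ 2 $ 2) var_z) * partial_z p"

definition Hom_poly :: "nat \<Rightarrow> ('a::field poly poly) set" where
  "Hom_poly N = bipoly.span {var_y ^ (N - i) * var_z ^ i | i. i \<le> N}"

section \<open>Leonard pairs\<close>

text \<open>Ordered bases of the whole type are indexed by \<open>0, \<dots>, d\<close>.\<close>

definition ordered_basis ::
  "('a::field \<Rightarrow> 'v::ab_group_add \<Rightarrow> 'v) \<Rightarrow> nat \<Rightarrow> (nat \<Rightarrow> 'v) \<Rightarrow> bool" where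
  "ordered_basis scl d b \<longleftrightarrow>
     inj_on b {..d} \<and> \<not> module.dependent scl (b ` {..d}) \<and> module.span scl (b ` {..d}) = UNIV"

definition represents ::
  "('a::field \<Rightarrow> 'v::ab_group_add \<Rightarrow> 'v) \<Rightarrow> nat \<Rightarrow> (nat \<Rightarrow> 'v) \<Rightarrow> (nat \<Rightarrow> nat \<Rightarrow> 'a) \<Rightarrow> ('v \<Rightarrow> 'v) \<Rightarrow> bool"
  where
  "represents scl d b M T \<longleftrightarrow> (\<forall>j\<le>d. T (b j) = (\<Sum>i\<le>d. scl (M i j) (b i)))"

definition diagonal_matrix :: "nat \<Rightarrow> (nat \<Rightarrow> nat \<Rightarrow> 'a::field) \<Rightarrow> bool" where
  "diagonal_matrix d M \<longleftrightarrow> (\<forall>i\<le>d. \<forall>j\<le>d. i \<noteq> j \<longrightarrow> M i j = 0)"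

definition irreducible_tridiagonal :: "nat \<Rightarrow> (nat \<Rightarrow> nat \<Rightarrow> 'a::field) \<Rightarrow> bool" where
  "irreducible_tridiagonal d M \<longleftrightarrow>
     (\<forall>i\<le>d. \<forall>j\<le>d. (i > Suc j \<or> j > Suc i) \<longrightarrow> M i j = 0) \<and>
     (\<forall>i<d. M (Suc i) i \<noteq> 0 \<and> M i (Suc i) \<noteq> 0)"

definition diameter :: "('a::field \<Rightarrow> 'v::ab_group_add \<Rightarrow> 'v) \<Rightarrow> nat" where
  "diameter scl = vector_space.dim scl UNIV - 1"

definition leonard_basis ::
  "('a::field \<Rightarrow> 'v::ab_group_add \<Rightarrow> 'v) \<Rightarrow> ('v \<Rightarrow> 'v) \<Rightarrow> ('v \<Rightarrow> 'v) \<Rightarrow> (nat \<Rightarrow> 'v) \<Rightarrow>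
   (nat \<Rightarrow> nat \<Rightarrow> 'a) \<Rightarrow> (nat \<Rightarrow> nat \<Rightarrow> 'a) \<Rightarrow> bool" where
  "leonard_basis scl X Y b M D \<longleftrightarrow>
     ordered_basis scl (diameter scl) b \<and>
     represents scl (diameter scl) b M X \<and> irreducible_tridiagonal (diameter scl) M \<and>
     represents scl (diameter scl) b D Y \<and> diagonal_matrix (diameter scl) D"

text \<open>Since \<open>dim\<close> is 0 for infinite-dimensional spaces, \<open>dim UNIV > 0\<close> expresses finite
  positive dimension.\<close>

definition leonard_pair ::
  "('a::field \<Rightarrow> 'v::ab_group_add \<Rightarrow> 'v) \<Rightarrow> ('v \<Rightarrow> 'v) \<Rightarrow> ('v \<Rightarrow> 'v) \<Rightarrow> bool" where
  "leonard_pair scl A A' \<longleftrightarrow>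
     vector_space scl \<and> vector_space.dim scl UNIV > 0 \<and>
     Vector_Spaces.linear scl scl A \<and> Vector_Spaces.linear scl scl A' \<and>
     (\<exists>b M D. leonard_basis scl A A' b M D) \<and>
     (\<exists>b M D. leonard_basis scl A' A b M D)"

text \<open>Only the values \<open>\<theta> 0, \<dots>, \<theta> d\<close> with \<open>d\<close> the diameter matter.\<close>

definition eigenvalue_sequence ::
  "('a::field \<Rightarrow> 'v::ab_group_add \<Rightarrow> 'v) \<Rightarrow> ('v \<Rightarrow> 'v) \<Rightarrow> ('v \<Rightarrow> 'v) \<Rightarrow> (nat \<Rightarrow> 'a) \<Rightarrow> bool" where
  "eigenvalue_sequence scl A A' \<theta> \<longleftrightarrow>
     (\<exists>b M D. leonard_basis scl A' A b M D \<and> (\<forall>i\<le>diameter scl. D i i = \<theta> i))"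

definition dual_eigenvalue_sequence ::
  "('a::field \<Rightarrow> 'v::ab_group_add \<Rightarrow> 'v) \<Rightarrow> ('v \<Rightarrow> 'v) \<Rightarrow> ('v \<Rightarrow> 'v) \<Rightarrow> (nat \<Rightarrow> 'a) \<Rightarrow> bool" where
  "dual_eigenvalue_sequence scl A A' \<theta> \<longleftrightarrow>
     (\<exists>b M D. leonard_basis scl A A' b M D \<and> (\<forall>i\<le>diameter scl. D i i = \<theta> i))"

definition feasible :: "'a::field itself \<Rightarrow> nat \<Rightarrow> bool" where
  "feasible TYPE('a) N \<longleftrightarrow> CHAR('a) = 0 \<or> N < CHAR('a)"

definition krawtchouk_type ::
  "('a::field \<Rightarrow> 'v::ab_group_add \<Rightarrow> 'v) \<Rightarrow> ('v \<Rightarrow> 'v) \<Rightarrow> ('v \<Rightarrow> 'v) \<Rightarrow> bool" where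
  "krawtchouk_type scl A A' \<longleftrightarrow>
     leonard_pair scl A A' \<and> feasible TYPE('a) (diameter scl) \<and>
     eigenvalue_sequence scl A A' (\<lambda>i. of_nat (diameter scl) - 2 * of_nat i) \<and>
     dual_eigenvalue_sequence scl A A' (\<lambda>i. of_nat (diameter scl) - 2 * of_nat i)"

section \<open>Consistency of the definitions\<close>

lemmas sl2_basis_defs = sl2_e_def sl2_h_def sl2_f_def

lemma sl2_iff: "u \<in> sl2 \<longleftrightarrow> u $ 2 $ 2 = - (u $ 1 $ 1)"
  by (auto simp: sl2_def trace_def sum_2 eq_neg_iff_add_eq_0 add.commute)

lemma sl2_basis_distinct:
  "sl2_e \<noteq> (sl2_h :: 'a::field^2^2)" "sl2_e \<noteq> (sl2_f :: 'a^2^2)" "sl2_h \<noteq> (sl2_f :: 'a^2^2)"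
  by (simp_all add: sl2_basis_defs vec_eq_iff forall_2 vector_2)

lemma sum_sl2_basis:
  "(\<Sum>b\<in>{sl2_e, sl2_h, sl2_f :: 'a::field^2^2}. g b) = g sl2_e + g sl2_h + g sl2_f"
  using sl2_basis_distinct[where 'a = 'a] by (simp add: add.assoc)

lemma sl2_basis_expand:
  "u \<in> sl2 \<Longrightarrow>
   u = mat_scale (u $ 1 $ 2) sl2_e + mat_scale (u $ 1 $ 1) sl2_h + mat_scale (u $ 2 $ 1) sl2_f"
  by (simp add: sl2_iff sl2_basis_defs mat_scale_def vec_eq_iff forall_2 vector_2)

lemma sl2_basis_independent: "mat2.independent {sl2_e, sl2_h, sl2_f :: 'a::field^2^2}"
proof -
  have "\<forall>b\<in>{sl2_e, sl2_h, sl2_f}. g b = 0"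
    if "(\<Sum>b\<in>{sl2_e, sl2_h, sl2_f :: 'a^2^2}. mat_scale (g b) b) = 0" for g
    using that unfolding sum_sl2_basis
    by (simp add: sl2_basis_defs mat_scale_def vec_eq_iff forall_2 vector_2)
  then show ?thesis
    by (subst mat2.dependent_finite) auto
qed

lemma sl2_basis_span: "mat2.span {sl2_e, sl2_h, sl2_f} = (sl2 :: ('a::field^2^2) set)"
proof
  have "mat2.subspace (sl2 :: ('a^2^2) set)"
    by (auto simp: mat2.subspace_def sl2_iff mat_scale_def)
  moreover have "{sl2_e, sl2_h, sl2_f} \<subseteq> (sl2 :: ('a^2^2) set)"
    by (auto simp: sl2_iff sl2_basis_defs vector_2)
  ultimately show "mat2.span {sl2_e, sl2_h, sl2_f} \<subseteq> (sl2 :: ('a^2^2) set)"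
    by (rule mat2.span_minimal[rotated])
  show "(sl2 :: ('a^2^2) set) \<subseteq> mat2.span {sl2_e, sl2_h, sl2_f}"
  proof
    fix u :: "'a^2^2" assume "u \<in> sl2"
    show "u \<in> mat2.span {sl2_e, sl2_h, sl2_f}"
      by (subst sl2_basis_expand[OF \<open>u \<in> sl2\<close>])
        (intro mat2.span_add mat2.span_scale mat2.span_base; simp)
  qed
qed

lemma sl2_representation:
  assumes "u \<in> (sl2 :: ('a::field^2^2) set)"
  shows "mat2.representation {sl2_e, sl2_h, sl2_f} u sl2_e = u $ 1 $ 2"
    and "mat2.representation {sl2_e, sl2_h, sl2_f} u sl2_h = u $ 1 $ 1"
    and "mat2.representation {sl2_e, sl2_h, sl2_f} u sl2_f = u $ 2 $ 1"
proof -
  have "(\<Sum>b\<in>{sl2_e, sl2_h, sl2_f}. mat_scale (mat2.representation {sl2_e, sl2_h, sl2_f} u b) b) = u"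
    by (rule mat2.sum_representation_eq) (use assms sl2_basis_independent sl2_basis_span in auto)
  from this[unfolded sum_sl2_basis]
  show "mat2.representation {sl2_e, sl2_h, sl2_f} u sl2_e = u $ 1 $ 2"
    and "mat2.representation {sl2_e, sl2_h, sl2_f} u sl2_h = u $ 1 $ 1"
    and "mat2.representation {sl2_e, sl2_h, sl2_f} u sl2_f = u $ 2 $ 1"
    by (auto simp: sl2_basis_defs mat_scale_def vec_eq_iff forall_2 vector_2)
qed

lemma lie_bracket_in_sl2: "lie_bracket u v \<in> sl2"
  by (simp add: sl2_iff lie_bracket_def matrix_matrix_mult_def sum_2 algebra_simps)

lemma sl2_form_eq_trace:
  assumes char: "CHAR('a::field) \<noteq> 2" and "u \<in> sl2" "v \<in> sl2"
  shows "sl2_form u v = trace (u ** v :: 'a^2^2) / 2"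
proof -
  have "(2 :: 'a) \<noteq> 0"
  proof
    assume "(2 :: 'a) = 0"
    then have "CHAR('a) dvd 2"
      using of_nat_eq_0_iff_char_dvd[of 2, where 'a = 'a] by simp
    with char have "CHAR('a) = 1"
      by (metis dvd_antisym prime_nat_iff two_is_prime_nat)
    then show False by simp
  qed
  moreover have "(8 :: 'a) = 2 * (2 * 2)" "(4 :: 'a) = 2 * 2" by simp_all
  moreover have "killing_form u v = 4 * trace (u ** v)"
    using assms(2,3) unfolding killing_form_def sum_sl2_basis
    by (simp add: sl2_representation lie_bracket_in_sl2)
      (simp add: sl2_iff lie_bracket_def matrix_matrix_mult_def sum_2 trace_def
        sl2_basis_defs vector_2 algebra_simps)
  ultimately show ?thesis
    unfolding sl2_form_def by (metis mult.commute mult_divide_mult_cancel_left no_zero_divisors)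
qed

lemma partial_y_add: "partial_y (p + q) = partial_y p + partial_y q"
  by (simp add: partial_y_def poly_eq_iff coeff_map_poly pderiv_add)

lemma partial_y_scale: "partial_y (bipoly_scale c p) = bipoly_scale c (partial_y p)"
  by (simp add: partial_y_def bipoly_scale_def poly_eq_iff coeff_map_poly pderiv_smult)

lemma partial_y_mult: "partial_y (p * q) = partial_y p * q + p * partial_y q"
proof -
  interpret pd: additive "pderiv :: 'a poly \<Rightarrow> 'a poly"
    by unfold_locales (rule pderiv_add)
  show ?thesis
    by (rule poly_eqI)
      (simp add: partial_y_def coeff_map_poly coeff_mult pd.sum pderiv_mult sum.distrib
        mult.commute[of "pderiv _"] add.commute)
qed

lemma partial_z_scale: "partial_z (bipoly_scale c p) = bipoly_scale c (partial_z p)"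
  by (simp add: partial_z_def bipoly_scale_def pderiv_smult)

lemma bipoly_act_add: "bipoly_act u (p + q) = bipoly_act u p + bipoly_act u q"
  by (simp add: bipoly_act_def partial_y_add partial_z_def pderiv_add algebra_simps)

lemma bipoly_act_scale: "bipoly_act u (bipoly_scale c p) = bipoly_scale c (bipoly_act u p)"
  by (simp add: bipoly_act_def partial_y_scale partial_z_scale)
    (simp add: bipoly_scale_def smult_add_right)

lemma bipoly_act_derivation: "bipoly_act u (p * q) = bipoly_act u p * q + p * bipoly_act u q"
  by (simp add: bipoly_act_def partial_y_mult partial_z_def pderiv_mult algebra_simps)

lemma partial_generators:
  "partial_y var_y = 1" "partial_y var_z = 0" "partial_z var_y = 0" "partial_z var_z = 1"
  by (simp_all add: partial_y_def partial_z_def var_y_def var_z_def map_poly_pCons pderiv_pCons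
      one_pCons)

lemma bipoly_act_generators:
  "bipoly_act sl2_e var_y = 0" "bipoly_act sl2_h var_y = var_y" "bipoly_act sl2_f var_y = var_z"
  "bipoly_act sl2_e var_z = var_y" "bipoly_act sl2_h var_z = - var_z" "bipoly_act sl2_f var_z = 0"
  by (simp_all add: bipoly_act_def partial_generators sl2_basis_defs vector_2)

lemma bipoly_act_left_linear:
  "bipoly_act (u + v) p = bipoly_act u p + bipoly_act v p"
  "bipoly_act (mat_scale c u) p = bipoly_scale c (bipoly_act u p)"
  by (simp_all add: bipoly_act_def mat_scale_def bipoly.scale_left_distrib algebra_simps
      flip: bipoly.scale_scale)
    (simp add: bipoly_scale_def smult_add_right algebra_simps)

lemma bipoly_act_unique:
  fixes D :: "'a::field poly poly \<Rightarrow> 'a poly poly"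
  assumes add: "\<And>p q. D (p + q) = D p + D q"
    and scale: "\<And>c p. D (bipoly_scale c p) = bipoly_scale c (D p)"
    and leibniz: "\<And>p q. D (p * q) = D p * q + p * D q"
    and y: "D var_y = bipoly_act u var_y" and z: "D var_z = bipoly_act u var_z"
  shows "D = bipoly_act u"
proof -
  have one: "E 1 = 0" if "\<And>p q. E (p * q) = E p * q + p * E q" for E :: "'a poly poly \<Rightarrow> _"
    using that[of 1 1] by (metis add_cancel_left_left mult_1 mult_1_right)
  have const: "D [:[:c:]:] = bipoly_act u [:[:c:]:]" for c
  proof -
    have "[:[:c:]:] = bipoly_scale c 1" by (simp add: bipoly_scale_def one_pCons)
    then show ?thesis
      by (simp add: scale bipoly_act_scale one[of D, OF leibniz]
          one[of "bipoly_act u", OF bipoly_act_derivation])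
  qed
  have inner: "D [:q:] = bipoly_act u [:q:]" for q
  proof (induction q)
    case 0
    show ?case using const[of 0] by simp
  next
    case (pCons a q)
    have "[:pCons a q:] = [:[:a:]:] + var_y * [:q:]" by (simp add: var_y_def)
    then show ?case
      by (simp only: add leibniz bipoly_act_add bipoly_act_derivation const pCons y)
  qed
  show ?thesis
  proof
    fix p show "D p = bipoly_act u p"
    proof (induction p)
      case 0
      show ?case using const[of 0] by simp
    next
      case (pCons a p)
      have "pCons a p = [:a:] + var_z * p" by (simp add: var_z_def)
      then show ?case
        by (simp add: add leibniz bipoly_act_add bipoly_act_derivation inner pCons z)
    qed
  qed
qed

lemma bipoly_act_bracket:
  fixes p :: "'a::field poly poly"
  assumes "u \<in> sl2" "v \<in> sl2"
  shows "bipoly_act (lie_bracket u v) p =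
    bipoly_act u (bipoly_act v p) - bipoly_act v (bipoly_act u p)"
proof -
  let ?D = "\<lambda>p. bipoly_act u (bipoly_act v p) - bipoly_act v (bipoly_act u p)"
  have gens: "bipoly_act w var_y = bipoly_scale (w$1$1) var_y + bipoly_scale (w$2$1) var_z"
    "bipoly_act w var_z = bipoly_scale (w$1$2) var_y + bipoly_scale (w$2$2) var_z"
    for w :: "'a^2^2"
    by (simp_all add: bipoly_act_def partial_generators)
  have "?D = bipoly_act (lie_bracket u v)"
  proof (rule bipoly_act_unique)
    show "?D var_y = bipoly_act (lie_bracket u v) var_y"
      "?D var_z = bipoly_act (lie_bracket u v) var_z"
      by (simp_all add: gens bipoly_act_add bipoly_act_scale lie_bracket_def
          matrix_matrix_mult_def sum_2 bipoly.scale_left_distrib bipoly.scale_right_distrib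
          bipoly.scale_left_diff_distrib mult.commute)
  qed (simp_all add: bipoly_act_add bipoly_act_scale bipoly_act_derivation algebra_simps)
  then show ?thesis by (metis (no_types))
qed

lemma bipoly_module: "sl2_module bipoly_scale UNIV bipoly_act"
  by (simp add: sl2_module_def bipoly.vector_space_axioms bipoly_act_add bipoly_act_scale
      bipoly_act_left_linear bipoly_act_bracket)

lemma Hom_poly_module: "sl2_module bipoly_scale (Hom_poly N) (bipoly_act :: 'a::field^2^2 \<Rightarrow> _)"
proof -
  let ?m = "\<lambda>i. var_y ^ (N - i) * var_z ^ i :: 'a poly poly"
  have pow: "bipoly_act u (q ^ n) = of_nat n * q ^ (n - 1) * bipoly_act u q" for u q n
  proof (induction n)
    case 0
    show ?case using bipoly_act_derivation[of u 1 1]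
      by (metis add_cancel_left_left mult_1 mult_1_right mult_zero_left of_nat_0 power_0)
  next
    case (Suc n)
    then show ?case
      by (cases n) (simp_all add: bipoly_act_derivation algebra_simps)
  qed
  have mem: "?m i \<in> Hom_poly N" if "i \<le> N" for i
    unfolding Hom_poly_def using that by (auto intro: bipoly.span_base)
  have scal: "bipoly_scale c q * r = bipoly_scale c (q * r)"
    "q * bipoly_scale c r = bipoly_scale c (q * r)"
    "of_nat n * q = bipoly_scale (of_nat n) q" for c and q r :: "'a poly poly" and n
    by (simp_all add: bipoly_scale_def of_nat_poly)
  have S: "bipoly.subspace (Hom_poly N :: 'a poly poly set)"
    unfolding Hom_poly_def by (rule bipoly.subspace_span)
  have gen: "bipoly_act u (?m i) \<in> Hom_poly N" if "i \<le> N" for u i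
  proof -
    have eq: "bipoly_act u (?m i) =
      bipoly_scale (of_nat (N - i)) (bipoly_scale (u$1$1) (var_y ^ (N - i - 1) * var_y * var_z ^ i)
        + bipoly_scale (u$2$1) (var_y ^ (N - i - 1) * var_z ^ Suc i)) +
      bipoly_scale (of_nat i) (bipoly_scale (u$1$2) (var_y ^ Suc (N - i) * var_z ^ (i - 1))
        + bipoly_scale (u$2$2) (var_y ^ (N - i) * (var_z ^ (i - 1) * var_z)))"
      unfolding bipoly_act_derivation pow
      by (simp add: bipoly_act_def partial_generators scal algebra_simps
          bipoly.scale_right_distrib)
    have 1: "bipoly_scale (of_nat (N - i)) (bipoly_scale (u$1$1) (var_y ^ (N - i - 1) * var_y * var_z ^ i)
        + bipoly_scale (u$2$1) (var_y ^ (N - i - 1) * var_z ^ Suc i)) \<in> Hom_poly N"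
    proof (cases "i = N")
      case True
      then show ?thesis using bipoly.subspace_0[OF S] by simp
    next
      case False
      then have "i < N" using that by simp
      then have "var_y ^ (N - i - 1) * var_y * var_z ^ i = ?m i"
        "var_y ^ (N - i - 1) * var_z ^ Suc i = ?m (Suc i)"
        by (simp_all add: Suc_diff_Suc flip: power_Suc2)
      then show ?thesis
        using mem[of i] mem[of "Suc i"] \<open>i < N\<close>
        by (simp only: bipoly.subspace_add[OF S] bipoly.subspace_scale[OF S] less_imp_le Suc_leI)
    qed
    have 2: "bipoly_scale (of_nat i) (bipoly_scale (u$1$2) (var_y ^ Suc (N - i) * var_z ^ (i - 1))
        + bipoly_scale (u$2$2) (var_y ^ (N - i) * (var_z ^ (i - 1) * var_z))) \<in> Hom_poly N"
    proof (cases i)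
      case 0
      then show ?thesis using bipoly.subspace_0[OF S] by simp
    next
      case (Suc j)
      then have "var_y ^ Suc (N - i) * var_z ^ (i - 1) = ?m j"
        "var_y ^ (N - i) * (var_z ^ (i - 1) * var_z) = ?m i"
        using that by (simp_all add: Suc_diff_Suc del: power_Suc flip: power_Suc2)
      then show ?thesis
        using mem[of i] mem[of j] that Suc
        by (simp only: bipoly.subspace_add[OF S] bipoly.subspace_scale[OF S] Suc_leD)
    qed
    show ?thesis unfolding eq by (rule bipoly.subspace_add[OF S 1 2])
  qed
  have closed: "bipoly_act u w \<in> Hom_poly N" if "w \<in> Hom_poly N" for u and w :: "'a poly poly"
    using that unfolding Hom_poly_def[of N, where 'a = 'a]
  proof (induction rule: bipoly.span_induct_alt)
    case base
    have "bipoly_act u 0 = 0" using bipoly_act_add[of u 0 0] by (metis add.right_neutral add_cancel_left_left)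
    then show ?case using bipoly.span_zero by simp
  next
    case (step c x w)
    then have "bipoly_act u x \<in> Hom_poly N" using gen by auto
    then show ?case using step unfolding Hom_poly_def
      by (simp add: bipoly_act_add bipoly_act_scale bipoly.span_add bipoly.span_scale)
  qed
  show ?thesis
    using bipoly_module S closed unfolding sl2_module_def by blast
qed

end

(* Let D be the diagonal part of A' in an eigenbasis u of A, so that 4D = 4A' - [A,[A,A']], and
   let D' be obtained by exchanging the roles of A and A' (with eigenbasis b of A').  The Jacobi
   identity gives [D,A'] = [A,D'].  Applied to b_0 it shows that D b_0 lies in the span of b_0 and
   A b_0; since D commutes with A and b_0 is cyclic for A, D = \<alpha> A + \<beta>, and likewise
   D' = \<alpha>' A' + \<beta>'.  The Jacobi identity again gives \<alpha> = \<alpha>', and comparing the first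
   and last coordinates of u_0 in the basis b gives \<beta> = \<beta>' = 0 and \<alpha>^2 \<noteq> 1.  Hence A and A'
   act as h and \<alpha> h + (1 - \<alpha>^2) e + f, and u_0 is a highest weight vector of weight N.
   Using coordinates of u_0 rather than traces covers the case N = p - 1, where the dimension
   vanishes in F. *)

theory Submission
  imports Defs
begin

section \<open>Coordinates with respect to an ordered basis\<close>

locale indexed_basis = vector_space scl
  for scl :: "'a::field \<Rightarrow> 'v::ab_group_add \<Rightarrow> 'v" (infixr \<open>\<odot>\<close> 75) +
  fixes d :: nat and b :: "nat \<Rightarrow> 'v"
  assumes basis: "ordered_basis scl d b"
begin

definition coord :: "nat \<Rightarrow> 'v \<Rightarrow> 'a" where
  "coord i v = representation (b ` {..d}) v (b i)"

lemma basis_facts: "inj_on b {..d}" "independent (b ` {..d})" "v \<in> span (b ` {..d})"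
  using basis by (auto simp: ordered_basis_def)

lemma coord_add [simp]: "coord i (v + w) = coord i v + coord i w"
  by (simp add: coord_def representation_add basis_facts)

lemma coord_scale [simp]: "coord i (c \<odot> v) = c * coord i v"
  by (simp add: coord_def representation_scale basis_facts)

lemma coord_diff [simp]: "coord i (v - w) = coord i v - coord i w"
  by (simp add: coord_def representation_diff basis_facts)

lemma coord_zero [simp]: "coord i 0 = 0"
  by (simp add: coord_def representation_zero)

lemma coord_uminus [simp]: "coord i (- v) = - coord i v"
  using coord_diff[of i 0 v] by simp

lemma coord_sum: "coord i (\<Sum>j\<in>J. f j) = (\<Sum>j\<in>J. coord i (f j))"
  by (induction J rule: infinite_finite_induct) simp_all

lemma coord_basis: "i \<le> d \<Longrightarrow> j \<le> d \<Longrightarrow> coord i (b j) = (if i = j then 1 else 0)"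
  unfolding coord_def
  using representation_basis[OF basis_facts(2), of "b j"] inj_onD[OF basis_facts(1), of i j]
  by auto

lemma coord_expansion: "(\<Sum>i\<le>d. coord i v \<odot> b i) = v"
proof -
  have "(\<Sum>w\<in>b ` {..d}. representation (b ` {..d}) v w \<odot> w) = v"
    by (rule sum_representation_eq[OF basis_facts(2)]) (auto simp: basis_facts)
  then show ?thesis
    by (simp add: sum.reindex[OF basis_facts(1)] coord_def)
qed

lemma coord_combination: "i \<le> d \<Longrightarrow> coord i (\<Sum>j\<le>d. x j \<odot> b j) = x i"
  by (simp add: coord_sum coord_basis if_distrib cong: if_cong)

lemma coord_eqI: "(\<And>i. i \<le> d \<Longrightarrow> coord i v = coord i w) \<Longrightarrow> v = w"
  by (metis (no_types, lifting) atMost_iff coord_expansion sum.cong)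

lemma coord_image:
  assumes T: "Vector_Spaces.linear scl scl T"
    and rep: "\<And>j. j \<le> d \<Longrightarrow> T (b j) = (\<Sum>i\<le>d. M i j \<odot> b i)" and "i \<le> d"
  shows "coord i (T v) = (\<Sum>j\<le>d. M i j * coord j v)"
proof -
  interpret T: Vector_Spaces.linear scl scl T by (fact T)
  have "T v = (\<Sum>j\<le>d. coord j v \<odot> T (b j))"
    by (subst coord_expansion[of v, symmetric]) (simp add: T.sum T.scale)
  then have "coord i (T v) = (\<Sum>j\<le>d. coord j v * coord i (T (b j)))"
    by (simp add: coord_sum)
  also have "\<dots> = (\<Sum>j\<le>d. M i j * coord j v)"
    using \<open>i \<le> d\<close> by (intro sum.cong) (simp_all add: rep coord_combination)
  finally show ?thesis .
qed

lemma coord_eigenbasis: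
  assumes T: "Vector_Spaces.linear scl scl T"
    and eig: "\<And>j. j \<le> d \<Longrightarrow> T (b j) = t j \<odot> b j" and "i \<le> d"
  shows "coord i (T v) = t i * coord i v"
proof -
  interpret T: Vector_Spaces.linear scl scl T by (fact T)
  have "T v = (\<Sum>j\<le>d. coord j v \<odot> T (b j))"
    by (subst coord_expansion[of v, symmetric]) (simp add: T.sum T.scale)
  also have "\<dots> = (\<Sum>j\<le>d. (t j * coord j v) \<odot> b j)"
    by (intro sum.cong) (simp_all add: eig mult.commute)
  finally show ?thesis using \<open>i \<le> d\<close> by (simp only: coord_combination)
qed

lemma linear_eq_on_basis:
  assumes "module_hom scl scl' S" "module_hom scl scl' T" "\<And>i. i \<le> d \<Longrightarrow> S (b i) = T (b i)"
  shows "S v = T v"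
proof -
  interpret S: module_hom scl scl' S by fact
  interpret T: module_hom scl scl' T by fact
  have "S (\<Sum>i\<le>d. coord i v \<odot> b i) = T (\<Sum>i\<le>d. coord i v \<odot> b i)"
    by (simp add: S.sum T.sum S.scale T.scale assms(3))
  then show ?thesis by (simp add: coord_expansion)
qed

end

section \<open>Irreducible tridiagonal matrices\<close>

text \<open>The guards drop missing neighbours: at \<open>i = 0\<close> the truncated
  \<open>i - 1\<close> would count the diagonal term twice, and at \<open>i = d\<close> the index
  \<open>Suc i\<close> is out of range.\<close>

lemma tridiagonal_row_sum:
  fixes M :: "nat \<Rightarrow> nat \<Rightarrow> 'a::field"
  assumes "irreducible_tridiagonal d M" "i \<le> d"
  shows "(\<Sum>j\<le>d. M i j * g j) =
    (if i = 0 then 0 else M i (i - 1) * g (i - 1)) + M i i * g i +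
    (if i = d then 0 else M i (Suc i) * g (Suc i))"
proof -
  have "(\<Sum>j\<le>d. M i j * g j) = (\<Sum>j\<in>{i - 1..Suc i} \<inter> {..d}. M i j * g j)"
    using assms by (intro sum.mono_neutral_right) (auto simp: irreducible_tridiagonal_def)
  also have "{i - 1..Suc i} \<inter> {..d} =
      (if i = 0 then {} else {i - 1}) \<union> ({i} \<union> (if i = d then {} else {Suc i}))"
    using assms(2) by auto
  finally show ?thesis by (auto simp: algebra_simps)
qed

text \<open>Row \<open>k\<close> of the eigenvalue equation is a three-term recurrence; as
  \<open>M k (Suc k)\<close> is nonzero, it determines \<open>x (Suc k)\<close> from the earlier
  coordinates.\<close>

lemma tridiagonal_eigenvector_first:
  fixes M :: "nat \<Rightarrow> nat \<Rightarrow> 'a::field"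
  assumes M: "irreducible_tridiagonal d M"
    and eig: "\<And>i. i \<le> d \<Longrightarrow> (\<Sum>j\<le>d. M i j * x j) = t * x i"
    and "x 0 = 0" "i \<le> d"
  shows "x i = 0"
  using \<open>i \<le> d\<close>
proof (induction i rule: less_induct)
  case (less i)
  show ?case
  proof (cases i)
    case 0
    then show ?thesis using \<open>x 0 = 0\<close> by simp
  next
    case (Suc k)
    have "M k i * x i = 0"
      using eig[of k] less Suc unfolding tridiagonal_row_sum[OF M Suc_leD[OF less.prems[unfolded Suc]]]
      by (auto split: if_splits)
    then show ?thesis using M less.prems Suc by (auto simp: irreducible_tridiagonal_def)
  qed
qed

text \<open>Reversing the index order by \<open>i\<close> to \<open>d - i\<close> preserves
  irreducible tridiagonality and reduces this to the first coordinate.\<close>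

lemma tridiagonal_eigenvector_last:
  fixes M :: "nat \<Rightarrow> nat \<Rightarrow> 'a::field"
  assumes M: "irreducible_tridiagonal d M"
    and eig: "\<And>i. i \<le> d \<Longrightarrow> (\<Sum>j\<le>d. M i j * x j) = t * x i"
    and "x d = 0" "i \<le> d"
  shows "x i = 0"
proof -
  have "irreducible_tridiagonal d (\<lambda>i j. M (d - i) (d - j))"
    unfolding irreducible_tridiagonal_def
  proof (intro conjI allI impI)
    fix i assume "i < d"
    then have "d - i = Suc (d - Suc i)" "d - Suc i < d" by auto
    then show "M (d - Suc i) (d - i) \<noteq> 0" "M (d - i) (d - Suc i) \<noteq> 0"
      using M unfolding irreducible_tridiagonal_def by metis+
  qed (use M in \<open>auto simp: irreducible_tridiagonal_def\<close>)
  moreover have "(\<Sum>j\<le>d. M (d - i) (d - j) * x (d - j)) = t * x (d - i)" for i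
    using eig[of "d - i"] sum.atLeastAtMost_rev[of "\<lambda>j. M (d - i) j * x j" 0 d]
    by (simp add: atMost_atLeast0)
  ultimately have "x (d - (d - i)) = 0"
    using tridiagonal_eigenvector_first[of d "\<lambda>i j. M (d - i) (d - j)" "\<lambda>i. x (d - i)" t "d - i"]
      \<open>x d = 0\<close> by simp
  then show ?thesis using \<open>i \<le> d\<close> by simp
qed

section \<open>Pairs of Krawtchouk type\<close>

locale krawtchouk_bases = vector_space scl
  for scl :: "'a::field \<Rightarrow> 'v::ab_group_add \<Rightarrow> 'v" (infixr \<open>\<odot>\<close> 75) +
  fixes d :: nat and b u :: "nat \<Rightarrow> 'v" and M M' :: "nat \<Rightarrow> nat \<Rightarrow> 'a"
    and A A' :: "'v \<Rightarrow> 'v"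
  assumes linear_A: "Vector_Spaces.linear scl scl A"
    and linear_A': "Vector_Spaces.linear scl scl A'"
    and basis_b: "ordered_basis scl d b" and basis_u: "ordered_basis scl d u"
    and tridiagonal: "irreducible_tridiagonal d M"
    and tridiagonal': "irreducible_tridiagonal d M'"
    and A_b: "\<And>j. j \<le> d \<Longrightarrow> A (b j) = (\<Sum>i\<le>d. M i j \<odot> b i)"
    and A'_b: "\<And>j. j \<le> d \<Longrightarrow> A' (b j) = (of_nat d - 2 * of_nat j) \<odot> b j"
    and A_u: "\<And>j. j \<le> d \<Longrightarrow> A (u j) = (of_nat d - 2 * of_nat j) \<odot> u j"
    and A'_u: "\<And>j. j \<le> d \<Longrightarrow> A' (u j) = (\<Sum>i\<le>d. M' i j \<odot> u i)"
    and two_neq_0: "(2 :: 'a) \<noteq> 0"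
    and feasible_d: "feasible TYPE('a) d"
begin

sublocale b: indexed_basis scl d b by unfold_locales (fact basis_b)
sublocale u: indexed_basis scl d u by unfold_locales (fact basis_u)
sublocale A: Vector_Spaces.linear scl scl A by (fact linear_A)
sublocale A': Vector_Spaces.linear scl scl A' by (fact linear_A')

text \<open>The hypotheses are symmetric, so each result on \<open>diag\<close> also holds for
  \<open>krawtchouk_bases.diag scl A' A\<close>, four times the diagonal part of \<open>A\<close> in
  the eigenbasis \<open>b\<close> of \<open>A'\<close>.\<close>

lemma swap: "krawtchouk_bases scl d u b M' M A' A"
  by unfold_locales (use A_b A'_b A_u A'_u in \<open>auto simp: basis_b basis_u tridiagonal tridiagonal'
      two_neq_0 feasible_d\<close>)

lemma of_nat_eq_0: "i \<le> d \<Longrightarrow> (of_nat i :: 'a) = 0 \<longleftrightarrow> i = 0"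
  using feasible_d by (auto simp: feasible_def of_nat_eq_0_iff_char_dvd dest: dvd_imp_le)

text \<open>Four times the diagonal part of \<open>A'\<close> in the basis \<open>u\<close>: the squared differences of
  neighbouring eigenvalues of \<open>A\<close> are all equal to 4.\<close>

definition diag :: "'v \<Rightarrow> 'v" where
  "diag v = 4 \<odot> A' v - (A (A (A' v)) - 2 \<odot> A (A' (A v)) + A' (A (A v)))"

section \<open>The diagonal part of \<open>A'\<close> as an affine function of
  \<open>A\<close>\<close>

lemma diag_linear: "module_hom scl scl diag"
  by unfold_locales
    (simp_all add: diag_def A.add A'.add A.scale A'.scale scale_right_distrib
      scale_right_diff_distrib mult.commute)

text \<open>In an eigenbasis of \<open>A\<close> with eigenvalues \<open>t\<close>, the double
  commutator multiplies the entry \<open>M' k i\<close> by \<open>(t k - t i)^2\<close>. This is 4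
  for neighbours, which cancels the term \<open>4 A'\<close>; entries further off the diagonal are
  zero anyway.\<close>

lemma diag_u:
  assumes "i \<le> d" shows "diag (u i) = (4 * M' i i) \<odot> u i"
proof (rule u.coord_eqI)
  fix k assume k: "k \<le> d"
  let ?t = "\<lambda>i. of_nat d - 2 * of_nat i :: 'a"
  have A: "u.coord k (A v) = ?t k * u.coord k v" for v
    using k by (intro u.coord_eigenbasis[OF linear_A]) (simp_all add: A_u)
  have A': "u.coord k (A' (u i)) = M' k i"
    using assms k by (simp add: A'_u u.coord_combination)
  have "u.coord k (diag (u i)) = (4 - (?t k - ?t i)\<^sup>2) * M' k i"
    using assms by (simp add: diag_def A A' A_u A'.scale A.scale A'.diff A.diff A'.add A.add
        power2_eq_square algebra_simps)
  also have "\<dots> = u.coord k ((4 * M' i i) \<odot> u i)"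
  proof -
    consider "k = i" | "k = Suc i \<or> i = Suc k" | "M' k i = 0" "k \<noteq> i"
      using tridiagonal' assms k unfolding irreducible_tridiagonal_def by force
    then show ?thesis
      by cases (use assms k in \<open>auto simp: u.coord_basis power2_eq_square algebra_simps\<close>)
  qed
  finally show "u.coord k (diag (u i)) = u.coord k ((4 * M' i i) \<odot> u i)" .
qed

lemma diag_commute: "diag (A v) = A (diag v)"
proof -
  interpret D: module_hom scl scl diag by (rule diag_linear)
  show ?thesis
  proof (rule u.linear_eq_on_basis[of scl "\<lambda>v. diag (A v)" "\<lambda>v. A (diag v)"])
    show "module_hom scl scl (\<lambda>v. diag (A v))" "module_hom scl scl (\<lambda>v. A (diag v))"
      by unfold_locales (simp_all add: A.add D.add A.scale D.scale)
  qed (simp add: A_u diag_u D.scale A.scale mult.commute)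
qed

text \<open>The vector \<open>b 0\<close> is cyclic for \<open>A\<close>: since
  \<open>M (Suc k) k\<close> is nonzero, \<open>A (b k)\<close> expresses \<open>b (Suc k)\<close>
  through \<open>b 0\<close>, ..., \<open>b k\<close> and itself.\<close>

lemma commuting_zero:
  assumes T: "module_hom scl scl T" and comm: "\<And>v. T (A v) = A (T v)" and zero: "T (b 0) = 0"
  shows "T v = 0"
proof -
  interpret T: module_hom scl scl T by fact
  have Tb: "T (b i) = 0" if "i \<le> d" for i
    using that
  proof (induction i rule: less_induct)
    case (less i)
    show ?case
    proof (cases i)
      case 0
      then show ?thesis using zero by simp
    next
      case (Suc k)
      have "0 = T (A (b k))"
        using less Suc by (simp add: comm)
      also have "\<dots> = (\<Sum>j\<le>d. M j k \<odot> T (b j))"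
        using less.prems Suc by (simp add: A_b T.sum T.scale)
      also have "\<dots> = (\<Sum>j\<in>{i}. M j k \<odot> T (b j))"
      proof (rule sum.mono_neutral_right)
        have "M j k = 0 \<or> T (b j) = 0" if "j \<le> d" "j \<noteq> i" for j
          using less Suc that tridiagonal unfolding irreducible_tridiagonal_def
          by (metis Suc_leD linorder_neqE_nat)
        then show "\<forall>j\<in>{..d} - {i}. M j k \<odot> T (b j) = 0" by auto
      qed (use less.prems in auto)
      finally have "M i k \<odot> T (b i) = 0" by simp
      then show ?thesis
        using tridiagonal less.prems Suc by (auto simp: irreducible_tridiagonal_def)
    qed
  qed
  have "T v = T (\<Sum>i\<le>d. b.coord i v \<odot> b i)" by (simp add: b.coord_expansion)
  then show ?thesis by (simp add: T.sum T.scale Tb)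
qed

text \<open>With \<open>C = [A, A']\<close> the two sides are \<open>[A', [A, C]]\<close> and
  \<open>[A, [A', C]]\<close>, which differ by \<open>[[A, A'], C] = [C, C] = 0\<close>.\<close>

lemma diag_jacobi:
  "diag (A' v) - A' (diag v) = A (krawtchouk_bases.diag scl A' A v) - krawtchouk_bases.diag scl A' A (A v)"
proof -
  interpret swap: krawtchouk_bases scl d u b M' M A' A by (rule swap)
  show ?thesis
    by (simp add: diag_def swap.diag_def A.add A.diff A.scale A'.add A'.diff A'.scale
        scale_right_distrib scale_right_diff_distrib algebra_simps)
qed

text \<open>Applied to \<open>b 0\<close>, the Jacobi identity puts \<open>diag (b 0)\<close> into the span of \<open>b 0\<close> and \<open>A (b 0)\<close>.\<close>

lemma diag_affine: "\<exists>\<alpha> \<beta>. \<forall>v. diag v = \<alpha> \<odot> A v + \<beta> \<odot> v"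
proof -
  interpret D: module_hom scl scl diag by (rule diag_linear)
  interpret swap: krawtchouk_bases scl d u b M' M A' A by (rule swap)
  interpret D': module_hom scl scl swap.diag by (rule swap.diag_linear)
  \<comment> \<open>In the Jacobi identity at \<open>b 0\<close>, coordinate \<open>i\<close> of the
    left side is \<open>2 i\<close> times the wanted one. On the right, \<open>swap.diag\<close> is
    diagonal in \<open>b\<close>, so everything stays in the span of \<open>b 0\<close> and
    \<open>b 1\<close>. Feasibility makes \<open>2 i\<close> invertible.\<close>
  have c2: "b.coord i (diag (b 0)) = 0" if i: "i \<le> d" "i \<ge> 2" for i
  proof -
    let ?t = "\<lambda>i. of_nat d - 2 * of_nat i :: 'a"
    have A': "b.coord i (A' v) = ?t i * b.coord i v" for v
      using i by (intro b.coord_eigenbasis[OF linear_A']) (simp_all add: A'_b)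
    have M0: "M i 0 = 0" using tridiagonal i by (auto simp: irreducible_tridiagonal_def)
    have "b.coord i (diag (A' (b 0)) - A' (diag (b 0))) =
      2 * of_nat i * b.coord i (diag (b 0))"
      by (simp add: A'_b D.scale A' algebra_simps)
    moreover have "swap.diag (A (b 0)) = (\<Sum>j\<le>d. (M j 0 * (4 * M j j)) \<odot> b j)"
      by (simp add: A_b D'.sum D'.scale swap.diag_u)
    then have "b.coord i (A (swap.diag (b 0)) - swap.diag (A (b 0))) = 0"
      using i M0 by (simp add: swap.diag_u A.scale A_b b.coord_combination)
    ultimately show ?thesis
      unfolding diag_jacobi using two_neq_0 of_nat_eq_0[OF i(1)] i by auto
  qed
  \<comment> \<open>The two scalars are forced by coordinates 1 and 0 of \<open>diag (b 0)\<close>;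
    for \<open>d = 0\<close> there is no coordinate 1, and 0 serves.\<close>
  define \<alpha> where "\<alpha> = (if d = 0 then 0 else b.coord 1 (diag (b 0)) / M 1 0)"
  define \<beta> where "\<beta> = b.coord 0 (diag (b 0)) - \<alpha> * M 0 0"
  have M10: "M (Suc 0) 0 \<noteq> 0" if "d \<noteq> 0"
    using tridiagonal that by (auto simp: irreducible_tridiagonal_def)
  have b0: "diag (b 0) = \<alpha> \<odot> A (b 0) + \<beta> \<odot> b 0"
  proof (rule b.coord_eqI)
    fix i assume "i \<le> d"
    consider "i = 0" | "i = 1" | "i \<ge> 2" by linarith
    then show "b.coord i (diag (b 0)) = b.coord i (\<alpha> \<odot> A (b 0) + \<beta> \<odot> b 0)"
    proof cases
      case 3
      then have "M i 0 = 0" using tridiagonal \<open>i \<le> d\<close> by (auto simp: irreducible_tridiagonal_def)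
      then show ?thesis using 3 \<open>i \<le> d\<close>
        by (simp add: c2 A_b b.coord_combination b.coord_basis)
    qed (use \<open>i \<le> d\<close> M10 in \<open>auto simp: A_b b.coord_combination b.coord_basis \<alpha>_def \<beta>_def\<close>)
  qed
  have "diag v - (\<alpha> \<odot> A v + \<beta> \<odot> v) = 0" for v
  proof (rule commuting_zero[where T = "\<lambda>v. diag v - (\<alpha> \<odot> A v + \<beta> \<odot> v)"])
    show "module_hom scl scl (\<lambda>v. diag v - (\<alpha> \<odot> A v + \<beta> \<odot> v))"
      by unfold_locales
        (simp_all add: D.add D.scale A.add A.scale scale_right_distrib scale_right_diff_distrib
          mult.commute)
  qed (simp_all add: b0 diag_commute A.diff A.add A.scale)
  then show ?thesis by (metis eq_iff_diff_eq_0)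
qed

section \<open>Coordinates of \<open>u 0\<close> in the eigenbasis of \<open>A'\<close>\<close>

text \<open>The left side is \<open>(A - d) (A' (u 0))\<close>. Removing the \<open>u 0\<close>
  component from \<open>A' (u 0)\<close> leaves a multiple of \<open>u 1\<close>, on which
  \<open>A - d\<close> is \<open>-2\<close>.\<close>

lemma u0_commutator: "A (A' (u 0)) - A' (A (u 0)) = (- 2) \<odot> (A' (u 0) - M' 0 0 \<odot> u 0)"
proof (rule u.coord_eqI)
  fix k assume k: "k \<le> d"
  have A: "u.coord k (A v) = (of_nat d - 2 * of_nat k) * u.coord k v" for v
    using k by (intro u.coord_eigenbasis[OF linear_A]) (simp_all add: A_u)
  have A': "u.coord k (A' (u 0)) = M' k 0"
    using k by (simp add: A'_u u.coord_combination)
  have "u.coord k (A (A' (u 0)) - A' (A (u 0))) = - 2 * of_nat k * M' k 0"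
    by (simp add: A A' A_u A'.scale A'.diff algebra_simps)
  also have "\<dots> = u.coord k ((- 2) \<odot> (A' (u 0) - M' 0 0 \<odot> u 0))"
  proof -
    have "of_nat k * M' k 0 = M' k 0 - M' 0 0 * (if k = 0 then 1 else 0)"
    proof -
      consider "k = 0" | "k = 1" | "k \<ge> 2" by linarith
      then show ?thesis
        by cases (use k tridiagonal' in \<open>auto simp: irreducible_tridiagonal_def\<close>)
    qed
    moreover have "u.coord k ((- 2) \<odot> (A' (u 0) - M' 0 0 \<odot> u 0)) =
        - 2 * (M' k 0 - M' 0 0 * (if k = 0 then 1 else 0))"
      using k by (simp only: u.coord_scale u.coord_diff A' u.coord_basis le0)
    ultimately show ?thesis by (simp only: mult.assoc)
  qed
  finally show "u.coord k (A (A' (u 0)) - A' (A (u 0))) =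
    u.coord k ((- 2) \<odot> (A' (u 0) - M' 0 0 \<odot> u 0))" .
qed

text \<open>Row \<open>i\<close> of \<open>A (u 0) = d (u 0)\<close> gives the sum of the two
  neighbour terms. Since \<open>A'\<close> is diagonal in \<open>b\<close> with steps of 2, row
  \<open>i\<close> of \<open>u0_commutator\<close> gives their difference. Solving yields each term
  separately.\<close>

lemma u0_coords:
  defines "x \<equiv> \<lambda>i. b.coord i (u 0)"
  assumes "i \<le> d"
  shows "2 * (if i = 0 then 0 else M i (i - 1) * x (i - 1)) =
      (2 * of_nat i - M i i + M' 0 0) * x i" (is "2 * ?l = _")
    and "2 * (if i = d then 0 else M i (Suc i) * x (Suc i)) =
      (2 * of_nat d - 2 * of_nat i - M i i - M' 0 0) * x i" (is "2 * ?r = _")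
proof -
  let ?t = "\<lambda>i. of_nat d - 2 * of_nat i :: 'a"
  have A: "b.coord i (A v) = (\<Sum>j\<le>d. M i j * b.coord j v)" for v
    using \<open>i \<le> d\<close> by (intro b.coord_image[OF linear_A]) (simp_all add: A_b)
  have A': "b.coord j (A' v) = ?t j * b.coord j v" if "j \<le> d" for j v
    using that by (intro b.coord_eigenbasis[OF linear_A']) (simp_all add: A'_b)
  have row: "(\<Sum>j\<le>d. M i j * x j) = of_nat d * x i"
    using A[of "u 0"] by (simp add: A_u x_def)
  have "b.coord i (A (A' (u 0))) - b.coord i (A' (A (u 0))) = - 2 * (?t i - M' 0 0) * x i"
    using arg_cong[OF u0_commutator, of "b.coord i"] \<open>i \<le> d\<close> by (simp add: A' x_def algebra_simps)
  moreover have "b.coord i (A (A' (u 0))) = (\<Sum>j\<le>d. M i j * (?t j * x j))"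
    by (simp add: A A' x_def)
  moreover have "b.coord i (A' (A (u 0))) = ?t i * (of_nat d * x i)"
    using \<open>i \<le> d\<close> by (simp add: A' A_u x_def)
  ultimately have com: "(\<Sum>j\<le>d. M i j * (?t j * x j)) =
      ?t i * (of_nat d * x i) - 2 * (?t i - M' 0 0) * x i"
    by (simp add: algebra_simps)
  define l r where "l = ?l" and "r = ?r"
  have 1: "l + M i i * x i + r = of_nat d * x i"
    using row unfolding tridiagonal_row_sum[OF tridiagonal \<open>i \<le> d\<close>] l_def r_def by simp
  have "(\<Sum>j\<le>d. M i j * (?t j * x j)) = (?t i + 2) * l + ?t i * (M i i * x i) + (?t i - 2) * r"
    unfolding tridiagonal_row_sum[OF tridiagonal \<open>i \<le> d\<close>] l_def r_def
    by (cases i) (auto simp: algebra_simps)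
  also have "\<dots> = ?t i * (l + M i i * x i + r) + 2 * (l - r)"
    by (simp add: algebra_simps)
  finally have "2 * (l - r) = 2 * (- (?t i - M' 0 0) * x i)"
    unfolding com 1 by (simp add: algebra_simps)
  then have 2: "l - r = - (?t i - M' 0 0) * x i"
    using two_neq_0 by (metis mult_cancel_left)
  have "2 * l = (l + M i i * x i + r) - M i i * x i + (l - r)"
    "2 * r = (l + M i i * x i + r) - M i i * x i - (l - r)"
    by (simp_all add: algebra_simps)
  then show "2 * ?l = (2 * of_nat i - M i i + M' 0 0) * x i"
    "2 * ?r = (2 * of_nat d - 2 * of_nat i - M i i - M' 0 0) * x i"
    unfolding 1 2 l_def[symmetric] r_def[symmetric] by (simp_all add: algebra_simps)
qed

lemma u0_coord_first: "b.coord 0 (u 0) \<noteq> 0"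
  and u0_coord_last: "b.coord d (u 0) \<noteq> 0"
proof -
  have "(\<Sum>j\<le>d. M i j * b.coord j (u 0)) = of_nat d * b.coord i (u 0)" if "i \<le> d" for i
    using b.coord_image[OF linear_A A_b that, of "u 0"] by (simp add: A_u)
  then have "b.coord i (u 0) = 0" if "i \<le> d" "b.coord 0 (u 0) = 0 \<or> b.coord d (u 0) = 0" for i
    using that tridiagonal_eigenvector_first[OF tridiagonal, of "\<lambda>i. b.coord i (u 0)"]
      tridiagonal_eigenvector_last[OF tridiagonal, of "\<lambda>i. b.coord i (u 0)"] by blast
  then have "u 0 = 0" if "b.coord 0 (u 0) = 0 \<or> b.coord d (u 0) = 0"
    using that by (intro b.coord_eqI) simp
  then show "b.coord 0 (u 0) \<noteq> 0" "b.coord d (u 0) \<noteq> 0"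
    using u.coord_basis[of 0 0] by auto
qed

section \<open>Both diagonal parts are multiples of the operators\<close>

lemma four_neq_0: "(4 :: 'a) \<noteq> 0"
  using no_zero_divisors[OF two_neq_0 two_neq_0] by simp

text \<open>These are the relations \<open>[A, [A, A']] = 4 A' - 4 \<alpha> A\<close> and
  \<open>[A', [A', A]] = 4 A - 4 \<alpha> A'\<close>, from which the action of \<open>sl2\<close> is
  built.\<close>

lemma diag_proportional:
  "\<exists>\<alpha>. \<alpha>\<^sup>2 \<noteq> 1 \<and> (\<forall>v. diag v = (4 * \<alpha>) \<odot> A v) \<and>
    (\<forall>v. krawtchouk_bases.diag scl A' A v = (4 * \<alpha>) \<odot> A' v)"
proof -
  interpret swap: krawtchouk_bases scl d u b M' M A' A by (rule swap)
  show ?thesis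
  proof (cases "d = 0")
    \<comment> \<open>The only eigenvalue is 0, so both operators vanish.\<close>
    case True
    have zero: "module_hom scl scl (\<lambda>_. 0)"
      by unfold_locales simp_all
    have "A v = 0" for v
      by (rule u.linear_eq_on_basis[OF A.module_hom_axioms zero]) (use True A_u[of 0] in simp)
    moreover have "A' v = 0" for v
      by (rule b.linear_eq_on_basis[OF A'.module_hom_axioms zero]) (use True A'_b[of 0] in simp)
    ultimately show ?thesis by (intro exI[of _ 0]) (simp add: diag_def swap.diag_def)
  next
    case False
    \<comment> \<open>Here \<open>\<alpha>\<close> is still four times the scalar of the claim; the
      witness at the end is \<open>\<alpha> / 4\<close>.\<close>
    obtain \<alpha> \<beta> where D: "\<And>v. diag v = \<alpha> \<odot> A v + \<beta> \<odot> v"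
      using diag_affine by blast
    obtain \<alpha>' \<beta>' where D': "\<And>v. swap.diag v = \<alpha>' \<odot> A' v + \<beta>' \<odot> v"
      using swap.diag_affine by blast
    have M'10: "M' (Suc 0) 0 \<noteq> 0" and M10: "M (Suc 0) 0 \<noteq> 0" and Mlast: "M (d - 1) d \<noteq> 0"
      using False tridiagonal tridiagonal'
      by (auto simp: irreducible_tridiagonal_def dest!: spec[of _ "d - 1"])
    have M': "4 * M' i i = \<alpha> * (of_nat d - 2 * of_nat i) + \<beta>" if "i \<le> d" for i
      using arg_cong[OF D[of "u i"], of "u.coord i"] that
      by (simp add: diag_u A_u u.coord_basis)
    have M: "4 * M i i = \<alpha>' * (of_nat d - 2 * of_nat i) + \<beta>'" if "i \<le> d" for i
      using arg_cong[OF D'[of "b i"], of "b.coord i"] that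
      by (simp add: swap.diag_u A'_b b.coord_basis)
    \<comment> \<open>With affine diagonal parts the Jacobi identity reads
      \<open>(\<alpha> - \<alpha>') [A, A'] = 0\<close>, and coordinate 1 of
      \<open>[A, A'] (u 0)\<close> is \<open>-2 M' 1 0\<close>, which is nonzero.\<close>
    have "(\<alpha> - \<alpha>') \<odot> (A (A' (u 0)) - A' (A (u 0))) = 0"
      using diag_jacobi[of "u 0"]
      by (simp add: D D' A.add A'.add A.scale A'.scale algebra_simps)
    then have "(\<alpha> - \<alpha>') * u.coord 1 ((- 2) \<odot> (A' (u 0) - M' 0 0 \<odot> u 0)) = 0"
      unfolding u0_commutator by (metis u.coord_scale u.coord_zero)
    then have \<alpha>: "\<alpha>' = \<alpha>"
      using False M'10 two_neq_0 by (simp add: A'_u u.coord_combination u.coord_basis)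
    \<comment> \<open>Row 0 has no left neighbour and row \<open>d\<close> no right one, so in these
      rows one equation of \<open>u0_coords\<close> has left side 0, and its nonzero coordinate of
      \<open>u 0\<close> can be cancelled.\<close>
    have "M' 0 0 = M 0 0"
      using u0_coords(1)[of 0] u0_coord_first by simp
    then have "\<beta> = \<beta>'"
      using M[of 0] M'[of 0] by (simp add: \<alpha> algebra_simps)
    moreover have "\<beta> + \<beta>' = 4 * (M d d + M' 0 0)"
      using M[of d] M'[of 0] by (simp add: \<alpha> algebra_simps)
    moreover have "M' 0 0 = - M d d"
      using u0_coords(2)[of d] u0_coord_last by simp
    ultimately have \<beta>: "\<beta> = 0" "\<beta>' = 0"
      using two_neq_0 by (simp_all flip: mult_2)
    have d1: "1 \<le> d" and pred: "Suc (d - 1) = d" "d - 1 \<noteq> d" using False by simp_all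
    \<comment> \<open>The coefficient of coordinate 1 in row 1 is \<open>2 + \<alpha> / 2\<close>.
      If it vanished, the product of \<open>M 1 0\<close> and the first coordinate of
      \<open>u 0\<close> would be 0. The value 4 is excluded likewise by row \<open>d - 1\<close>
      and the last coordinate.\<close>
    have "\<alpha> \<noteq> - 4"
    proof
      assume "\<alpha> = - 4"
      have "4 * (2 - M 1 1 + M' 0 0) = 8 - 4 * M 1 1 + 4 * M' 0 0"
        by (simp add: algebra_simps)
      also have "\<dots> = 0"
        unfolding M'[OF le0] M[OF d1] \<alpha> \<beta> \<open>\<alpha> = - 4\<close>
        by (simp add: algebra_simps)
      finally have "2 - M 1 1 + M' 0 0 = 0" using four_neq_0 by (metis mult_eq_0_iff)
      then show False
        using u0_coords(1)[of 1] u0_coord_first M10 two_neq_0 False by simp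
    qed
    moreover have "\<alpha> \<noteq> 4"
    proof
      assume "\<alpha> = 4"
      have "4 * (2 - M (d - 1) (d - 1) - M' 0 0) = 8 - 4 * M (d - 1) (d - 1) - 4 * M' 0 0"
        by (simp add: algebra_simps)
      also have "\<dots> = 0"
        using d1 unfolding M'[OF le0] M[OF diff_le_self] \<alpha> \<beta> \<open>\<alpha> = 4\<close>
        by (simp add: algebra_simps of_nat_diff)
      finally have "2 - M (d - 1) (d - 1) - M' 0 0 = 0" using four_neq_0 by (metis mult_eq_0_iff)
      then show False
        using u0_coords(2)[of "d - 1"] u0_coord_last Mlast two_neq_0 d1 pred
        unfolding pred(1) by (simp add: of_nat_diff)
    qed
    ultimately have "(\<alpha> / 4)\<^sup>2 \<noteq> 1"
      using four_neq_0 by (auto simp: power2_eq_1_iff divide_eq_eq)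
    then show ?thesis
      using four_neq_0 by (intro exI[of _ "\<alpha> / 4"]) (simp add: D D' \<alpha> \<beta>)
  qed
qed

end

section \<open>Modules from operators satisfying the \<open>sl\<^sub>2\<close> relations\<close>

text \<open>The linear extension of \<open>h\<close>, \<open>e\<close>, \<open>f\<close> to
  \<open>H\<close>, \<open>E\<close>, \<open>F\<close>; the entry \<open>w $ 2 $ 2\<close> is
  determined by trace zero.\<close>

definition triple_act ::
  "('a::field \<Rightarrow> 'v::ab_group_add \<Rightarrow> 'v) \<Rightarrow> ('v \<Rightarrow> 'v) \<Rightarrow> ('v \<Rightarrow> 'v) \<Rightarrow> ('v \<Rightarrow> 'v) \<Rightarrow> 'a^2^2 \<Rightarrow> 'v \<Rightarrow> 'v"
  where "triple_act scl H E F w v =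
    scl (w $ 1 $ 1) (H v) + scl (w $ 1 $ 2) (E v) + scl (w $ 2 $ 1) (F v)"

lemma triple_act_module:
  assumes "module_hom scl scl H" "module_hom scl scl E" "module_hom scl scl F" "vector_space scl"
    and HE: "\<And>v. H (E v) = E (H v) + scl 2 (E v)"
    and HF: "\<And>v. H (F v) = F (H v) - scl 2 (F v)"
    and EF: "\<And>v. E (F v) = F (E v) + H v"
  shows "sl2_module scl UNIV (triple_act scl H E F)"
proof -
  interpret vector_space scl by fact
  interpret H: module_hom scl scl H by fact
  interpret E: module_hom scl scl E by fact
  interpret F: module_hom scl scl F by fact
  let ?act = "triple_act scl H E F"
  have "?act (lie_bracket w w') v = ?act w (?act w' v) - ?act w' (?act w v)"
    if "w \<in> sl2" "w' \<in> sl2" for w w' v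
    using that unfolding triple_act_def
    by (simp add: sl2_iff lie_bracket_def matrix_matrix_mult_def sum_2 H.add E.add F.add H.scale
        E.scale F.scale HE HF EF H.diff E.diff F.diff scale_right_distrib scale_right_diff_distrib
        algebra_simps)
  then show ?thesis
    unfolding sl2_module_def
    by (simp add: vector_space_axioms triple_act_def mat_scale_def H.add E.add F.add H.scale
        E.scale F.scale scale_right_distrib scale_left_distrib mult.commute)
qed

section \<open>The module of homogeneous polynomials\<close>

lemma var_monomial:
  fixes c :: "'a::field"
  shows "bipoly_scale c (var_y ^ n * var_z ^ i) = monom (monom c n) i"
proof -
  have "var_y ^ n = [:monom (1 :: 'a) n:]"
    by (induction n) (simp_all add: var_y_def one_pCons monom_Suc)
  moreover have "var_z ^ i = monom (1 :: 'a poly) i"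
    by (simp add: var_z_def monom_altdef)
  ultimately show ?thesis
    by (simp add: bipoly_scale_def smult_monom)
qed

text \<open>At \<open>i = 0\<close> and \<open>i = N\<close> truncated subtraction produces
  meaningless monomials, but their coefficients \<open>of_nat i\<close> and
  \<open>of_nat (N - i)\<close> are then 0.\<close>

lemma bipoly_act_monomial:
  fixes w :: "'a::field^2^2"
  assumes "w \<in> sl2" "i \<le> N"
  shows "bipoly_act w (var_y ^ (N - i) * var_z ^ i) =
    bipoly_scale ((of_nat N - 2 * of_nat i) * w $ 1 $ 1) (var_y ^ (N - i) * var_z ^ i) +
    bipoly_scale (of_nat i * w $ 1 $ 2) (var_y ^ (N - (i - 1)) * var_z ^ (i - 1)) +
    bipoly_scale (of_nat (N - i) * w $ 2 $ 1) (var_y ^ (N - Suc i) * var_z ^ Suc i)"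
proof -
  define n where "n = N - i"
  have N: "N = n + i" using assms(2) by (simp add: n_def)
  have power: "D (p ^ n) = of_nat n * p ^ (n - 1) * D p"
    if "\<And>p q. D (p * q) = D p * q + p * D q" for D and p :: "'a poly poly" and n
  proof (induction n)
    case 0
    show ?case using that[of 1 1]
      by (metis add_cancel_left_left mult_1 mult_1_right mult_zero_left of_nat_0 power_0)
  next
    case (Suc n)
    then show ?case
      by (cases n) (simp_all add: that algebra_simps)
  qed
  have partial_z_mult: "partial_z (p * q) = partial_z p * q + p * partial_z q"
    for p q :: "'a poly poly"
    by (simp add: partial_z_def pderiv_mult algebra_simps)
  note powers = power[of partial_y, OF partial_y_mult] power[of partial_z, OF partial_z_mult]
  have y: "partial_y (var_y ^ n * var_z ^ i :: 'a poly poly) = of_nat n * var_y ^ (n - 1) * var_z ^ i"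
    by (simp add: partial_y_mult powers partial_generators)
  have z: "partial_z (var_y ^ n * var_z ^ i :: 'a poly poly) = of_nat i * var_y ^ n * var_z ^ (i - 1)"
    by (simp add: partial_z_mult powers partial_generators)
  have scale: "bipoly_scale c p = [:[:c:]:] * p" for c and p :: "'a poly poly"
    by (simp add: bipoly_scale_def)
  have const: "[:[:of_nat k * c:]:] = of_nat k * [:[:c:]:]" "[:[:- c:]:] = - [:[:c:]:]"
    "[:[:(of_nat N - 2 * of_nat i) * c:]:] = (of_nat n - of_nat i) * [:[:c:]:]"
    for k and c :: 'a
    by (simp_all add: of_nat_poly N algebra_simps)
  have w22: "w $ 2 $ 2 = - (w $ 1 $ 1)"
    using assms(1) by (simp add: sl2_iff)
  \<comment> \<open>Hiding the constant polynomials behind \<open>a\<close> keeps them as atoms, so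
    that a commutative ring identity remains.\<close>
  define a where "a c = [:[:c:]:]" for c :: 'a
  show ?thesis
    unfolding bipoly_act_def n_def[symmetric] y z scale const w22
    unfolding N a_def[symmetric] by (cases n; cases i) (simp_all add: algebra_simps)
qed

text \<open>The relation \<open>EF\<close> fixes the products \<open>p i * q i\<close>. Hence once
  the basis is rescaled so that \<open>F\<close> acts as on the monomials, \<open>E\<close> does so
  too.\<close>

lemma isomorphic_Hom_poly:
  fixes scl :: "'a::field \<Rightarrow> 'v::ab_group_add \<Rightarrow> 'v"
  assumes u: "ordered_basis scl d u" and "vector_space scl"
    and H: "module_hom scl scl H" and E: "module_hom scl scl E" and F: "module_hom scl scl F"
    and EF: "\<And>v. E (F v) = F (E v) + H v"
    and Hu: "\<And>i. i \<le> d \<Longrightarrow> H (u i) = scl (of_nat d - 2 * of_nat i) (u i)"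
    and Eu0: "E (u 0) = 0" and Eu: "\<And>i. i < d \<Longrightarrow> E (u (Suc i)) = scl (p i) (u i)"
    and Fud: "F (u d) = 0" and Fu: "\<And>i. i < d \<Longrightarrow> F (u i) = scl (q i) (u (Suc i))"
    and q: "\<And>i. i < d \<Longrightarrow> q i \<noteq> 0" and feas: "feasible TYPE('a) d"
  shows "sl2_module_isomorphic scl UNIV (triple_act scl H E F) bipoly_scale (Hom_poly d) bipoly_act"
proof -
  interpret vector_space scl by fact
  interpret indexed_basis scl d u by unfold_locales (fact u)
  interpret H: module_hom scl scl H by fact
  interpret E: module_hom scl scl E by fact
  interpret F: module_hom scl scl F by fact
  let ?m = "\<lambda>i. var_y ^ (d - i) * var_z ^ i :: 'a poly poly"
  have nonzero: "of_nat i \<noteq> (0 :: 'a)" if "i \<le> d" "i \<noteq> 0" for i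
    using feas that by (auto simp: feasible_def of_nat_eq_0_iff_char_dvd dest: dvd_imp_le)
  \<comment> \<open>Evaluating \<open>EF\<close> at \<open>u i\<close> gives a recurrence with
    increments equal to the weights \<open>d - 2 i\<close>.\<close>
  have pq: "p i * q i = of_nat (Suc i) * of_nat (d - i)" if "i < d" for i
    using that
  proof (induction i)
    case 0
    have "coord 0 (E (F (u 0))) = coord 0 (F (E (u 0)) + H (u 0))"
      by (simp only: EF)
    then show ?case
      using 0 by (simp add: Fu Eu Eu0 E.scale Hu coord_basis mult.commute)
  next
    case (Suc i)
    have "coord (Suc i) (E (F (u (Suc i)))) = coord (Suc i) (F (E (u (Suc i))) + H (u (Suc i)))"
      by (simp only: EF)
    then have "p (Suc i) * q (Suc i) = p i * q i + (of_nat d - 2 * of_nat (Suc i))"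
      using Suc.prems by (simp add: Fu Eu E.scale F.scale Hu coord_basis mult.commute)
    then show ?case
      using Suc by (simp add: of_nat_diff algebra_simps)
  qed
  \<comment> \<open>The map sends \<open>u i\<close> to the monomial \<open>?m i\<close> divided by
    \<open>k i\<close>; matching the action of \<open>F\<close> forces
    \<open>k (Suc i) = k i * q i / (d - i)\<close>. Feasibility keeps the denominators
    nonzero.\<close>
  define k where "k i = (\<Prod>j<i. q j / of_nat (d - j))" for i
  have k: "k i \<noteq> 0" if "i \<le> d" for i
  proof -
    have "q j / of_nat (d - j) \<noteq> 0" if "j < d" for j
      using q[OF that] nonzero[of "d - j"] that by (simp del: of_nat_diff)
    then show ?thesis using that by (simp add: k_def del: divide_eq_0_iff)
  qed
  have kS: "k (Suc i) * of_nat (d - i) = k i * q i" if "i < d" for i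
    using nonzero[of "d - i"] that by (simp add: k_def del: of_nat_diff)
  define \<phi> where "\<phi> v = (\<Sum>i\<le>d. bipoly_scale (coord i v / k i) (?m i))" for v
  interpret \<phi>: module_hom scl bipoly_scale \<phi>
    by unfold_locales
      (simp_all add: \<phi>_def add_divide_distrib bipoly.scale_left_distrib bipoly.scale_sum_right
        sum.distrib)
  have \<phi>u: "\<phi> (u j) = bipoly_scale (1 / k j) (?m j)" if "j \<le> d" for j
  proof -
    have "\<phi> (u j) = (\<Sum>i\<le>d. if i = j then bipoly_scale (1 / k j) (?m j) else 0)"
      unfolding \<phi>_def using that by (intro sum.cong) (auto simp: coord_basis)
    then show ?thesis using that by simp
  qed
  have intertwine: "\<phi> (triple_act scl H E F w v) = bipoly_act w (\<phi> v)" if w: "w \<in> sl2" for w v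
  proof (rule linear_eq_on_basis[of bipoly_scale "\<lambda>v. \<phi> (triple_act scl H E F w v)"
        "\<lambda>v. bipoly_act w (\<phi> v)"])
    show "module_hom scl bipoly_scale (\<lambda>v. \<phi> (triple_act scl H E F w v))"
      by unfold_locales
        (simp_all add: triple_act_def H.add E.add F.add H.scale E.scale F.scale \<phi>.add \<phi>.scale
          scale_right_distrib bipoly.scale_right_distrib mult.commute)
    show "module_hom scl bipoly_scale (\<lambda>v. bipoly_act w (\<phi> v))"
      by unfold_locales (simp_all add: \<phi>.add \<phi>.scale bipoly_act_add bipoly_act_scale)
    fix i assume i: "i \<le> d"
    have "\<phi> (E (u i)) = bipoly_scale (of_nat i / k i) (?m (i - 1))"
    proof (cases i)
      case 0
      then show ?thesis by (simp add: Eu0)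
    next
      case (Suc j)
      then have j: "j < d" using i by simp
      have "p j * (k j * q j) = of_nat (Suc j) * of_nat (d - j) * k j"
        using pq[OF j] by (simp add: algebra_simps)
      then have "p j * k (Suc j) = of_nat (Suc j) * k j"
        using nonzero[of "d - j"] j unfolding kS[OF j, symmetric] by simp
      then have "p j / k j = of_nat (Suc j) / k (Suc j)"
        using k[of j] k[of "Suc j"] j by (simp add: field_simps)
      then show ?thesis using Suc j by (simp add: Eu \<phi>.scale \<phi>u)
    qed
    moreover have "\<phi> (F (u i)) = bipoly_scale (of_nat (d - i) / k i) (?m (Suc i))"
    proof (cases "i = d")
      case True
      then show ?thesis by (simp add: Fud)
    next
      case False
      then have i: "i < d" using i by simp
      then have "q i / k (Suc i) = of_nat (d - i) / k i"
        using k[of i] k[of "Suc i"] kS[OF i] by (simp add: field_simps)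
      then show ?thesis using i by (simp add: Fu \<phi>.scale \<phi>u)
    qed
    ultimately show "\<phi> (triple_act scl H E F w (u i)) = bipoly_act w (\<phi> (u i))"
      unfolding triple_act_def \<phi>.add \<phi>.scale Hu[OF i] \<phi>u[OF i] bipoly_act_scale
        bipoly_act_monomial[OF w i]
      by (simp add: bipoly.scale_right_distrib mult.commute)
  qed
  have "inj \<phi>"
  proof (rule injI)
    fix v v' assume eq: "\<phi> v = \<phi> v'"
    \<comment> \<open>The monomials have distinct exponents, so coefficients recover the
      coordinates.\<close>
    have "coeff (coeff (\<phi> v) i) (d - i) = coord i v / k i" if "i \<le> d" for i v
      using that by (simp add: \<phi>_def var_monomial coeff_sum if_distrib[of "\<lambda>p. coeff p _"]
          cong: if_cong)
    then have "coord i v / k i = coord i v' / k i" if "i \<le> d" for i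
      using that eq by metis
    then show "v = v'"
      using k by (intro coord_eqI) simp
  qed
  moreover have "range \<phi> = Hom_poly d"
  proof
    show "range \<phi> \<subseteq> Hom_poly d"
      unfolding Hom_poly_def \<phi>_def
      by (intro image_subsetI bipoly.span_sum bipoly.span_scale bipoly.span_base) auto
    show "Hom_poly d \<subseteq> range \<phi>"
      unfolding Hom_poly_def
    proof (rule bipoly.span_minimal)
      have "?m i = \<phi> (scl (k i) (u i))" if "i \<le> d" for i
        using that k by (simp add: \<phi>.scale \<phi>u)
      then show "{?m i |i. i \<le> d} \<subseteq> range \<phi>" by auto
      show "bipoly.subspace (range \<phi>)"
        by (rule \<phi>.subspace_image) (rule subspace_UNIV)
    qed
  qed
  ultimately show ?thesis
    unfolding sl2_module_isomorphic_def
    by (intro exI[of _ \<phi>]) (simp add: bij_betw_def \<phi>.add \<phi>.scale intertwine)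
qed

section \<open>Raising and lowering operators built from the pair\<close>

context krawtchouk_bases
begin

text \<open>With \<open>A' = \<alpha> A + (1 - \<alpha>\<^sup>2) E + F\<close>, the commutator \<open>[A, A']\<close> is
  \<open>2 (1 - \<alpha>\<^sup>2) E - 2 F\<close>; the operators below solve these two equations for \<open>E\<close> and
  \<open>F\<close>.\<close>

definition raising :: "'a \<Rightarrow> 'v \<Rightarrow> 'v" where
  "raising \<alpha> v = (1 / (4 * (1 - \<alpha>\<^sup>2))) \<odot>
    (2 \<odot> (A' v - \<alpha> \<odot> A v) + (A (A' v) - A' (A v)))"

definition lowering :: "'a \<Rightarrow> 'v \<Rightarrow> 'v" where
  "lowering \<alpha> v = (1 / 4) \<odot> (2 \<odot> (A' v - \<alpha> \<odot> A v) - (A (A' v) - A' (A v)))"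

lemma raising_linear: "module_hom scl scl (raising \<alpha>)"
  by unfold_locales
    (simp_all add: raising_def A.add A'.add A.scale A'.scale scale_right_distrib
      scale_right_diff_distrib algebra_simps)

lemma lowering_linear: "module_hom scl scl (lowering \<alpha>)"
  by unfold_locales
    (simp_all add: lowering_def A.add A'.add A.scale A'.scale scale_right_distrib
      scale_right_diff_distrib algebra_simps)

lemma A'_decomposition:
  assumes "\<alpha>\<^sup>2 \<noteq> 1"
  shows "A' v = \<alpha> \<odot> A v + (1 - \<alpha>\<^sup>2) \<odot> raising \<alpha> v + lowering \<alpha> v"
proof -
  let ?x = "A' v - \<alpha> \<odot> A v" and ?b = "A (A' v) - A' (A v)"
  have "(1 - \<alpha>\<^sup>2) \<odot> raising \<alpha> v = (1 / 4) \<odot> (2 \<odot> ?x + ?b)"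
    using assms by (simp add: raising_def)
  then have "(1 - \<alpha>\<^sup>2) \<odot> raising \<alpha> v + lowering \<alpha> v = (1 / 4) \<odot> ((2 \<odot> ?x + ?b) + (2 \<odot> ?x - ?b))"
    by (simp only: lowering_def scale_right_distrib)
  also have "(2 \<odot> ?x + ?b) + (2 \<odot> ?x - ?b) = 4 \<odot> ?x"
    using scale_left_distrib[of 2 2 ?x] by simp
  finally show ?thesis
    using four_neq_0 by (simp add: algebra_simps)
qed

text \<open>With \<open>X = A' - \<alpha> A\<close> and \<open>B = [A, A']\<close> one has
  \<open>[A, X] = B\<close>, \<open>[A, B] = 4 X\<close> and
  \<open>[X, B] = -4 (1 - \<alpha>^2) A\<close>. So \<open>2 X + B\<close> and
  \<open>2 X - B\<close> are eigenvectors of \<open>ad A\<close> for 2 and -2.\<close>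

lemma
  assumes D: "\<And>v. diag v = (4 * \<alpha>) \<odot> A v"
    and D': "\<And>v. krawtchouk_bases.diag scl A' A v = (4 * \<alpha>) \<odot> A' v" and "\<alpha>\<^sup>2 \<noteq> 1"
  shows A_raising: "A (raising \<alpha> v) = raising \<alpha> (A v) + 2 \<odot> raising \<alpha> v"
    and A_lowering: "A (lowering \<alpha> v) = lowering \<alpha> (A v) - 2 \<odot> lowering \<alpha> v"
    and raising_lowering: "raising \<alpha> (lowering \<alpha> v) = lowering \<alpha> (raising \<alpha> v) + A v"
proof -
  interpret swap: krawtchouk_bases scl d u b M' M A' A by (rule swap)
  define X where "X v = A' v - \<alpha> \<odot> A v" for v
  define B where "B v = A (A' v) - A' (A v)" for v
  interpret X: module_hom scl scl X
    by unfold_locales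
      (simp_all add: X_def A.add A'.add A.scale A'.scale scale_right_distrib
        scale_right_diff_distrib mult.commute)
  interpret B: module_hom scl scl B
    by unfold_locales
      (simp_all add: B_def A.add A'.add A.scale A'.scale scale_right_diff_distrib)
  have AX: "A (X v) = X (A v) + B v" for v
    by (simp add: X_def B_def A.diff A.scale)
  have AB: "A (B v) = B (A v) + 4 \<odot> X v" for v
  proof -
    have "A (B v) - B (A v) = 4 \<odot> A' v - diag v"
      by (simp add: B_def diag_def A.diff scale_left_distrib[of 1 1, simplified])
    then show ?thesis
      unfolding D by (simp add: X_def scale_right_diff_distrib algebra_simps)
  qed
  have A'B: "A' (B v) = B (A' v) + 4 \<odot> (\<alpha> \<odot> A' v - A v)" for v
  proof -
    have "B (A' v) - A' (B v) = 4 \<odot> A v - swap.diag v"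
      by (simp add: B_def swap.diag_def A'.diff scale_left_distrib[of 1 1, simplified])
    then show ?thesis
      unfolding D' by (simp add: scale_right_diff_distrib algebra_simps)
  qed
  have XB: "X (B v) = B (X v) - (4 * (1 - \<alpha>\<^sup>2)) \<odot> A v" for v
    unfolding X_def[of "B v"] A'B AB
    by (simp add: X_def B.diff B.scale scale_right_diff_distrib scale_left_diff_distrib
        scale_right_distrib power2_eq_square algebra_simps)
  define c where "c = 4 * (1 - \<alpha>\<^sup>2)"
  have c: "c \<noteq> 0" using assms(3) four_neq_0 by (simp add: c_def)
  have E: "raising \<alpha> v = (1 / c) \<odot> (2 \<odot> X v + B v)"
    and F: "lowering \<alpha> v = (1 / 4) \<odot> (2 \<odot> X v - B v)" for v
    by (simp_all add: raising_def lowering_def X_def B_def c_def)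
  show "A (raising \<alpha> v) = raising \<alpha> (A v) + 2 \<odot> raising \<alpha> v"
    unfolding E by (simp add: A.add A.scale AX AB scale_right_distrib algebra_simps)
  show "A (lowering \<alpha> v) = lowering \<alpha> (A v) - 2 \<odot> lowering \<alpha> v"
    unfolding F
    by (simp add: A.diff A.scale AX AB scale_right_distrib scale_right_diff_distrib algebra_simps)
  have double: "4 \<odot> w = 2 \<odot> w + 2 \<odot> w" for w
    by (simp flip: scale_left_distrib)
  \<comment> \<open>This is \<open>[2 X + B, 2 X - B] = 4 [B, X]\<close>, applied to
    \<open>v\<close>.\<close>
  have "(2 \<odot> X (2 \<odot> X v - B v) + B (2 \<odot> X v - B v)) =
      (2 \<odot> X (2 \<odot> X v + B v) - B (2 \<odot> X v + B v)) + 4 \<odot> (B (X v) - X (B v))"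
    by (simp add: X.add X.diff X.scale B.add B.diff B.scale scale_right_distrib
        scale_right_diff_distrib double algebra_simps)
  also have "B (X v) - X (B v) = c \<odot> A v" by (simp add: XB c_def)
  finally have "(1 / (c * 4)) \<odot> (2 \<odot> X (2 \<odot> X v - B v) + B (2 \<odot> X v - B v)) =
      (1 / (c * 4)) \<odot> (2 \<odot> X (2 \<odot> X v + B v) - B (2 \<odot> X v + B v)) + A v"
    using c four_neq_0 by (simp add: scale_right_distrib)
  moreover have "raising \<alpha> (lowering \<alpha> v) =
      (1 / (c * 4)) \<odot> (2 \<odot> X (2 \<odot> X v - B v) + B (2 \<odot> X v - B v))"
    unfolding F[of v] module_hom.scale[OF raising_linear] E by (simp add: mult.commute)
  moreover have "lowering \<alpha> (raising \<alpha> v) =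
      (1 / (c * 4)) \<odot> (2 \<odot> X (2 \<odot> X v + B v) - B (2 \<odot> X v + B v))"
    unfolding E[of v] module_hom.scale[OF lowering_linear] F by (simp add: mult.commute)
  ultimately show "raising \<alpha> (lowering \<alpha> v) = lowering \<alpha> (raising \<alpha> v) + A v"
    by simp
qed

text \<open>By \<open>D\<close> the diagonal of \<open>M'\<close> is that of
  \<open>\<alpha> A\<close>, so subtracting \<open>\<alpha> A\<close> removes it. The commutator
  multiplies the entry \<open>M' k i\<close> by \<open>2 (i - k)\<close>; adding it to or
  subtracting it from twice the rest leaves one neighbour, with factor 4.\<close>

lemma
  assumes D: "\<And>v. diag v = (4 * \<alpha>) \<odot> A v" and "i \<le> d"
  shows raising_u: "raising \<alpha> (u i) =
      (if i = 0 then 0 else (M' (i - 1) i / (1 - \<alpha>\<^sup>2)) \<odot> u (i - 1))" (is ?R)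
    and lowering_u: "lowering \<alpha> (u i) = (if i = d then 0 else M' (Suc i) i \<odot> u (Suc i))" (is ?L)
proof -
  let ?t = "\<lambda>i. of_nat d - 2 * of_nat i :: 'a"
  have A: "u.coord k (A v) = ?t k * u.coord k v" if "k \<le> d" for k v
    using that by (intro u.coord_eigenbasis[OF linear_A]) (simp_all add: A_u)
  have A': "u.coord k (A' (u i)) = M' k i" if "k \<le> d" for k
    using that assms(2) by (simp add: A'_u u.coord_combination)
  have "4 * M' i i = 4 * (\<alpha> * ?t i)"
    using arg_cong[OF D[of "u i"], of "u.coord i"] assms(2)
    by (simp only: diag_u A u.coord_scale u.coord_basis if_True simp_thms mult_1_right mult.assoc)
  then have diagonal: "M' i i = \<alpha> * ?t i"
    using four_neq_0 by (metis mult_cancel_left)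
  have B: "u.coord k (A (A' (u i)) - A' (A (u i))) = (2 * of_nat i - 2 * of_nat k) * M' k i"
    and X: "u.coord k (A' (u i) - \<alpha> \<odot> A (u i)) = (if k = i then 0 else M' k i)" if "k \<le> d" for k
    using that assms(2) diagonal
    by (simp_all add: A A' A_u A'.diff A'.scale u.coord_basis algebra_simps)
  have up: "2 * (if k = i then 0 else M' k i) + (2 * of_nat i - 2 * of_nat k) * M' k i =
      4 * (if i = Suc k then M' k i else 0)"
    and down: "2 * (if k = i then 0 else M' k i) - (2 * of_nat i - 2 * of_nat k) * M' k i =
      4 * (if k = Suc i then M' k i else 0)" if k: "k \<le> d" for k
  proof -
    have "k = i \<or> k = Suc i \<or> i = Suc k \<or> M' k i = 0"
      using tridiagonal' k assms(2) unfolding irreducible_tridiagonal_def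
      by (metis Suc_lessI linorder_neqE_nat)
    then have "(2 * of_nat i - 2 * of_nat k) * M' k i =
      (if k = Suc i then - 2 else if i = Suc k then 2 else 0) * M' k i" by auto
    moreover have "2 * (if k = i then 0 else M' k i) =
      (if k = Suc i then 2 else if i = Suc k then 2 else 0) * M' k i"
      using \<open>k = i \<or> _\<close> by auto
    ultimately show "2 * (if k = i then 0 else M' k i) + (2 * of_nat i - 2 * of_nat k) * M' k i =
        4 * (if i = Suc k then M' k i else 0)"
      "2 * (if k = i then 0 else M' k i) - (2 * of_nat i - 2 * of_nat k) * M' k i =
        4 * (if k = Suc i then M' k i else 0)"
      by auto
  qed
  show ?R
  proof (rule u.coord_eqI)
    fix k assume k: "k \<le> d"
    show "u.coord k (raising \<alpha> (u i)) =
        u.coord k (if i = 0 then 0 else (M' (i - 1) i / (1 - \<alpha>\<^sup>2)) \<odot> u (i - 1))"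
      using four_neq_0 assms(2) k
      unfolding raising_def u.coord_scale u.coord_add B[OF k] X[OF k] up[OF k]
      by (cases i) (auto simp: u.coord_basis simp del: right_diff_distrib_numeral)
  qed
  show ?L
  proof (rule u.coord_eqI)
    fix k assume k: "k \<le> d"
    show "u.coord k (lowering \<alpha> (u i)) =
        u.coord k (if i = d then 0 else M' (Suc i) i \<odot> u (Suc i))"
      using four_neq_0 assms(2) k
      unfolding lowering_def u.coord_scale u.coord_diff[of k "2 \<odot> _"] B[OF k] X[OF k] down[OF k]
      by (auto simp: u.coord_basis)
  qed
qed

lemma sl2_structure:
  "\<exists>\<alpha> E F. \<alpha>\<^sup>2 \<noteq> 1 \<and> (\<forall>v. A' v = \<alpha> \<odot> A v + (1 - \<alpha>\<^sup>2) \<odot> E v + F v) \<and>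
    sl2_module scl UNIV (triple_act scl A E F) \<and>
    sl2_module_isomorphic scl UNIV (triple_act scl A E F) bipoly_scale (Hom_poly d) bipoly_act"
proof -
  obtain \<alpha> where \<alpha>: "\<alpha>\<^sup>2 \<noteq> 1" and D: "\<And>v. diag v = (4 * \<alpha>) \<odot> A v"
    and D': "\<And>v. krawtchouk_bases.diag scl A' A v = (4 * \<alpha>) \<odot> A' v"
    using diag_proportional by blast
  have "sl2_module scl UNIV (triple_act scl A (raising \<alpha>) (lowering \<alpha>))"
    by (rule triple_act_module[OF A.module_hom_axioms raising_linear lowering_linear
          vector_space_axioms A_raising[OF D D' \<alpha>] A_lowering[OF D D' \<alpha>] raising_lowering[OF D D' \<alpha>]])
  moreover have "sl2_module_isomorphic scl UNIV (triple_act scl A (raising \<alpha>) (lowering \<alpha>))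
      bipoly_scale (Hom_poly d) bipoly_act"
    by (rule isomorphic_Hom_poly[OF basis_u vector_space_axioms A.module_hom_axioms raising_linear
          lowering_linear raising_lowering[OF D D' \<alpha>],
          where p = "\<lambda>i. M' i (Suc i) / (1 - \<alpha>\<^sup>2)" and q = "\<lambda>i. M' (Suc i) i"])
      (use tridiagonal' in \<open>simp_all add: A_u raising_u[OF D] lowering_u[OF D] feasible_d
        irreducible_tridiagonal_def\<close>)
  ultimately show ?thesis
    using \<alpha> A'_decomposition[OF \<alpha>] by blast
qed

end

lemma (in vector_space) represents_diagonal:
  assumes "represents scale d b D T" "diagonal_matrix d D" "j \<le> d"
  shows "T (b j) = scale (D j j) (b j)"
proof -
  have "T (b j) = (\<Sum>i\<le>d. scale (D i j) (b i))"
    using assms by (simp add: represents_def)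
  also have "\<dots> = (\<Sum>i\<in>{j}. scale (D i j) (b i))"
    using assms by (intro sum.mono_neutral_right) (auto simp: diagonal_matrix_def)
  finally show ?thesis by simp
qed

section \<open>Pairs of normalized semisimple elements\<close>

text \<open>This is \<open>\<alpha> h + (1 - \<alpha>^2) e + f\<close>; the upper right entry makes
  the determinant -1, so the eigenvalues are 1 and -1.\<close>

definition partner :: "'a::field \<Rightarrow> 'a^2^2" where
  "partner \<alpha> = vector [vector [\<alpha>, 1 - \<alpha>\<^sup>2], vector [1, - \<alpha>]]"

lemma char_not_two: "(2 :: 'a::field) \<noteq> 0" if "CHAR('a) \<noteq> 2"
proof
  assume "(2 :: 'a) = 0"
  then have "CHAR('a) dvd 2"
    using of_nat_eq_0_iff_char_dvd[of 2, where 'a = 'a] by simp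
  with that have "CHAR('a) = 1"
    by (metis prime_nat_iff two_is_prime_nat)
  then show False by simp
qed

lemma mat2_independent_triple:
  assumes "\<And>p q r. mat_scale p x + mat_scale q y + mat_scale r z = 0 \<Longrightarrow> p = 0 \<and> q = 0 \<and> r = 0"
  shows "mat2.independent {x, y, z}"
proof -
  \<comment> \<open>Independence of a set does not see repetitions; two equal vectors would give a
    relation with coefficients 1 and -1.\<close>
  have "x \<noteq> y" "x \<noteq> z" "y \<noteq> z"
    using assms[of 1 "-1" 0] assms[of 1 0 "-1"] assms[of 0 1 "-1"] by auto
  then show ?thesis
    by (subst mat2.dependent_finite) (auto simp: add.assoc dest!: assms[unfolded add.assoc])
qed

lemma normalized_semisimple_h:
  assumes "CHAR('a::field) \<noteq> 2" shows "normalized_semisimple (sl2_h :: 'a^2^2)"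
proof -
  have h: "sl2_h \<in> (sl2 :: ('a^2^2) set)" by (simp add: sl2_iff sl2_h_def vector_2)
  have "lie_bracket sl2_h b = mat_scale (if b = sl2_e then 2 else if b = sl2_f then - 2 else 0) b"
    if "b \<in> {sl2_e, sl2_h, sl2_f}" for b :: "'a^2^2"
    using that sl2_basis_distinct[where 'a = 'a]
    by (auto simp: lie_bracket_def mat_scale_def sl2_basis_defs matrix_matrix_mult_def sum_2
        vec_eq_iff forall_2 vector_2)
  then have "semisimple (sl2_h :: 'a^2^2)"
    unfolding semisimple_def using h sl2_basis_independent sl2_basis_span by blast
  moreover have "sl2_form sl2_h (sl2_h :: 'a^2^2) = 1"
    using char_not_two[OF assms]
    unfolding sl2_form_eq_trace[OF assms h h]
    by (simp add: trace_def sl2_h_def matrix_matrix_mult_def sum_2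
        vector_2)
  ultimately show ?thesis by (simp add: normalized_semisimple_def)
qed

text \<open>\<open>x\<close> and \<open>y\<close> are the conjugates of \<open>e\<close> and \<open>f\<close> by the matrix whose columns are the
  eigenvectors \<open>(\<alpha> + 1, 1)\<close> and \<open>(\<alpha> - 1, 1)\<close> of \<open>partner \<alpha>\<close>, up to a factor 2; the
  coefficients in the spanning step are obtained from the trace form.\<close>

lemma normalized_semisimple_partner:
  fixes \<alpha> :: "'a::field"
  assumes "CHAR('a) \<noteq> 2" shows "normalized_semisimple (partner \<alpha>)"
proof -
  note two = char_not_two[OF assms]
  have four: "(4 :: 'a) \<noteq> 0"
    using no_zero_divisors[OF two two] by simp
  have sl2: "partner \<alpha> \<in> sl2" by (simp add: sl2_iff partner_def vector_2)
  define x :: "'a^2^2" where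
    "x = vector [vector [- (\<alpha> + 1), (\<alpha> + 1)\<^sup>2], vector [- 1, \<alpha> + 1]]"
  define y :: "'a^2^2" where
    "y = vector [vector [\<alpha> - 1, - (\<alpha> - 1)\<^sup>2], vector [1, 1 - \<alpha>]]"
  note defs = partner_def x_def y_def mat_scale_def vec_eq_iff forall_2 vector_2
  let ?B = "{partner \<alpha>, x, y}"
  have "mat2.independent ?B"
  proof (rule mat2_independent_triple)
    fix p q r
    assume 0: "mat_scale p (partner \<alpha>) + mat_scale q x + mat_scale r y = 0"
    have "(mat_scale p (partner \<alpha>) + mat_scale q x + mat_scale r y) $ i $ j = 0" for i j
      unfolding 0 by simp
    note entries = this[unfolded partner_def x_def y_def mat_scale_def vector_add_component
        vec_lambda_beta]
    have 1: "p * \<alpha> + q * - (\<alpha> + 1) + r * (\<alpha> - 1) = 0" and 2: "p * 1 + q * - 1 + r * 1 = 0"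
      and 3: "p * (1 - \<alpha>\<^sup>2) + q * (\<alpha> + 1)\<^sup>2 + r * - (\<alpha> - 1)\<^sup>2 = 0"
      using entries[of 1 1] entries[of 2 1] entries[of 1 2] by (simp_all only: vector_2)
    \<comment> \<open>This pairs the relation with \<open>partner \<alpha>\<close> under the trace
      form: \<open>x\<close> and \<open>y\<close> are orthogonal to it, and its square has trace
      2.\<close>
    have "2 * p = 2 * \<alpha> * (p * \<alpha> + q * - (\<alpha> + 1) + r * (\<alpha> - 1)) +
        (1 - \<alpha>\<^sup>2) * (p * 1 + q * - 1 + r * 1) +
        (p * (1 - \<alpha>\<^sup>2) + q * (\<alpha> + 1)\<^sup>2 + r * - (\<alpha> - 1)\<^sup>2)"
      by algebra
    then have p: "p = 0" unfolding 1 2 3 using two by simp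
    then have r: "r = q" using 2 by simp
    have "2 * q = - (p * \<alpha> + q * - (\<alpha> + 1) + r * (\<alpha> - 1))"
      unfolding p r by algebra
    then show "p = 0 \<and> q = 0 \<and> r = 0" unfolding 1 using p two r by simp
  qed
  moreover have "mat2.span ?B = sl2"
  proof
    show "mat2.span ?B \<subseteq> sl2"
    proof (rule mat2.span_minimal)
      show "?B \<subseteq> sl2" using sl2 by (simp add: sl2_iff x_def y_def vector_2)
      show "mat2.subspace (sl2 :: ('a^2^2) set)"
        by (auto simp: mat2.subspace_def sl2_iff mat_scale_def)
    qed
    show "sl2 \<subseteq> mat2.span ?B"
    proof
      fix w :: "'a^2^2" assume w: "w \<in> sl2"
      define p where "p = 2 * (2 * \<alpha> * w $ 1 $ 1 + (1 - \<alpha>\<^sup>2) * w $ 2 $ 1 + w $ 1 $ 2)"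
      define q where "q = 2 * (\<alpha> - 1) * w $ 1 $ 1 - (\<alpha> - 1)\<^sup>2 * w $ 2 $ 1 + w $ 1 $ 2"
      define r where "r = - (2 * (\<alpha> + 1)) * w $ 1 $ 1 + (\<alpha> + 1)\<^sup>2 * w $ 2 $ 1 - w $ 1 $ 2"
      have "mat_scale 4 w = mat_scale p (partner \<alpha>) + mat_scale q x + mat_scale r y"
        using w by (simp add: sl2_iff defs p_def q_def r_def power2_eq_square algebra_simps)
      then have "mat_scale 4 w \<in> mat2.span ?B"
        by (simp add: mat2.span_add mat2.span_scale mat2.span_base)
      then have "mat_scale (1 / 4) (mat_scale 4 w) \<in> mat2.span ?B"
        by (rule mat2.span_scale)
      then show "w \<in> mat2.span ?B" using four by simp
    qed
  qed
  moreover have "lie_bracket (partner \<alpha>) (partner \<alpha>) = mat_scale 0 (partner \<alpha>)"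
    "lie_bracket (partner \<alpha>) x = mat_scale 2 x" "lie_bracket (partner \<alpha>) y = mat_scale (- 2) y"
    by (simp_all add: defs lie_bracket_def matrix_matrix_mult_def sum_2 power2_eq_square
        algebra_simps)
  then have "\<forall>w\<in>?B. \<exists>c. lie_bracket (partner \<alpha>) w = mat_scale c w"
    by blast
  ultimately have "semisimple (partner \<alpha>)"
    unfolding semisimple_def using sl2 by blast
  moreover have "sl2_form (partner \<alpha>) (partner \<alpha>) = 1"
    using two
    unfolding sl2_form_eq_trace[OF assms sl2 sl2]
    by (simp add: trace_def partner_def
        matrix_matrix_mult_def sum_2 vector_2 power2_eq_square)
  ultimately show ?thesis by (simp add: normalized_semisimple_def)
qed

text \<open>As for \<open>raising\<close> and \<open>lowering\<close>:
  \<open>partner \<alpha> - \<alpha> h\<close> is \<open>(1 - \<alpha>^2) e + f\<close> and the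
  bracket is \<open>2 (1 - \<alpha>^2) e - 2 f\<close>. Since \<open>1 - \<alpha>^2\<close> is
  invertible, these yield \<open>e\<close> and \<open>f\<close>.\<close>

lemma generates_sl2_partner:
  fixes \<alpha> :: "'a::field"
  assumes "CHAR('a) \<noteq> 2" and "\<alpha>\<^sup>2 \<noteq> 1" shows "generates_sl2 {sl2_h, partner \<alpha>}"
proof -
  note two = char_not_two[OF assms(1)]
  have four: "(4 :: 'a) \<noteq> 0"
    using no_zero_divisors[OF two two] by simp
  have sub: "{sl2_h, partner \<alpha>} \<subseteq> sl2"
    by (simp add: sl2_iff partner_def sl2_h_def vector_2)
  have "lie_subalgebra (sl2 :: ('a^2^2) set)"
    by (auto simp: lie_subalgebra_def mat2.subspace_def sl2_iff mat_scale_def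
        lie_bracket_in_sl2[unfolded sl2_iff])
  then have "lie_subalgebra hull {sl2_h, partner \<alpha>} \<subseteq> sl2"
    using sub by (rule hull_minimal[rotated])
  moreover have "sl2 \<subseteq> lie_subalgebra hull {sl2_h, partner \<alpha>}"
    unfolding hull_def
  proof (rule Inter_greatest)
    fix S :: "('a^2^2) set"
    assume "S \<in> {S. lie_subalgebra S \<and> {sl2_h, partner \<alpha>} \<subseteq> S}"
    then have S: "mat2.subspace S" and br: "\<And>v w. v \<in> S \<Longrightarrow> w \<in> S \<Longrightarrow> lie_bracket v w \<in> S"
      and h: "sl2_h \<in> S" and a: "partner \<alpha> \<in> S"
      by (auto simp: lie_subalgebra_def)
    let ?b = "lie_bracket sl2_h (partner \<alpha>)"
    let ?c = "partner \<alpha> - mat_scale \<alpha> sl2_h"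
    have b: "?b \<in> S" and c: "?c \<in> S"
      using br[OF h a] h a by (simp_all add: mat2.subspace_diff[OF S] mat2.subspace_scale[OF S])
    note defs = lie_bracket_def mat_scale_def sl2_basis_defs partner_def matrix_matrix_mult_def
      sum_2 vec_eq_iff forall_2 vector_2
    have "sl2_e = mat_scale (1 / (4 * (1 - \<alpha>\<^sup>2))) (mat_scale 2 ?c + ?b)"
      using assms(2) four by (simp add: defs)
    then have e: "sl2_e \<in> S"
      by (metis S b c mat2.subspace_add mat2.subspace_scale)
    have "sl2_f = mat_scale (1 / 4) (mat_scale 2 ?c - ?b)"
      using four by (simp add: defs)
    then have f: "sl2_f \<in> S"
      by (metis S b c mat2.subspace_diff mat2.subspace_scale)
    have "mat2.span {sl2_e, sl2_h, sl2_f} \<subseteq> S"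
      using e f h S by (intro mat2.span_minimal) auto
    then show "sl2 \<subseteq> S" by (simp add: sl2_basis_span)
  qed
  ultimately show ?thesis using sub by (simp add: generates_sl2_def)
qed

theorem theorem6p4:
  fixes scl :: "'a::alg_closed_field \<Rightarrow> 'v::ab_group_add \<Rightarrow> 'v"
    and A A' :: "'v \<Rightarrow> 'v"
    and N :: nat
  assumes "CHAR('a) \<noteq> 2"
    and "feasible TYPE('a) N"
    and "vector_space scl"
    and "vector_space.dim scl UNIV = N + 1"
    and "leonard_pair scl A A'"
    and "krawtchouk_type scl A A'"
  shows "\<exists>act a a'.
           sl2_module scl UNIV act \<and>
           normalized_semisimple a \<and> normalized_semisimple a' \<and>
           generates_sl2 {a, a'} \<and>
           act a = A \<and> act a' = A' \<and>
           sl2_module_isomorphic scl UNIV act bipoly_scale (Hom_poly N) bipoly_act"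
proof -
  interpret vector_space scl by fact
  have d: "diameter scl = N"
    using assms(4) by (simp add: diameter_def)
  obtain u M' D' where u: "leonard_basis scl A' A u M' D'"
    and D': "\<And>i. i \<le> N \<Longrightarrow> D' i i = of_nat N - 2 * of_nat i"
    using assms(6) unfolding krawtchouk_type_def eigenvalue_sequence_def d by blast
  obtain b M D where b: "leonard_basis scl A A' b M D"
    and D: "\<And>i. i \<le> N \<Longrightarrow> D i i = of_nat N - 2 * of_nat i"
    using assms(6) unfolding krawtchouk_type_def dual_eigenvalue_sequence_def d by blast
  interpret krawtchouk_bases scl N b u M M' A A'
  proof (intro krawtchouk_bases.intro krawtchouk_bases_axioms.intro)
    show "vector_space scl" by fact
    show "Vector_Spaces.linear scl scl A" "Vector_Spaces.linear scl scl A'"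
      using assms(5) by (simp_all add: leonard_pair_def)
    show "ordered_basis scl N b" "ordered_basis scl N u"
      "irreducible_tridiagonal N M" "irreducible_tridiagonal N M'"
      using b u by (simp_all add: leonard_basis_def d)
    show "A (b j) = (\<Sum>i\<le>N. scl (M i j) (b i))" "A' (u j) = (\<Sum>i\<le>N. scl (M' i j) (u i))"
      if "j \<le> N" for j
      using b u that by (simp_all add: leonard_basis_def d represents_def)
    show "A' (b j) = scl (of_nat N - 2 * of_nat j) (b j)"
      "A (u j) = scl (of_nat N - 2 * of_nat j) (u j)" if "j \<le> N" for j
      using b u represents_diagonal[of N _ _ _ j] that unfolding leonard_basis_def d
      by (metis D, metis D')
  qed (use char_not_two[OF assms(1)] assms(2) in simp_all)
  obtain \<alpha> E F where \<alpha>: "\<alpha>\<^sup>2 \<noteq> 1"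
    and A': "\<And>v. A' v = scl \<alpha> (A v) + scl (1 - \<alpha>\<^sup>2) (E v) + F v"
    and act: "sl2_module scl UNIV (triple_act scl A E F)"
      "sl2_module_isomorphic scl UNIV (triple_act scl A E F) bipoly_scale (Hom_poly N) bipoly_act"
    using sl2_structure by blast
  \<comment> \<open>The witnesses are \<open>sl2_h\<close> and \<open>partner \<alpha>\<close>; for
    the latter the action is exactly the decomposition of \<open>A'\<close>.\<close>
  have "triple_act scl A E F sl2_h = A" "triple_act scl A E F (partner \<alpha>) = A'"
    by (auto simp: triple_act_def sl2_h_def partner_def vector_2 A')
  then show ?thesis
    using act normalized_semisimple_h[OF assms(1)] normalized_semisimple_partner[OF assms(1)]
      generates_sl2_partner[OF assms(1) \<alpha>] by blast
qed

end
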